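(* For every $\epsilon>0$ there exists $\gamma=\gamma(\epsilon)>0$ such that for every Hölder continuous function $\phi:\mathbb{R}\to\mathbb{R}$ with Hölder exponent at least $1-2\gamma$, the function $h_\phi(\lambda)=\int_{\mathbb{R}}\phi(x)\,d\mu_\lambda(x)$ is absolutely continuous on the interval $(2^{-1/3}+\epsilon,\,1-\epsilon)$.
   Context: For $\lambda\in(0,1)$, $\mu_\lambda$ denotes the (unbiased) infinite Bernoulli convolution: the law of the random variable $X(\lambda)=\sum_{m=1}^\infty a_m\lambda^{m-1}$, where $a_1,a_2,\dots$ are i.i.d. random variables taking the values $-1$ and $1$ with probability $\frac12$ each. *)

theory Defs
  imports "HOL-Probability.Probability"
begin

text \<open>
  The signs are realised on the product space of all sequences in \<open>{-1, 1}\<close>. They are indexed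
  from 0, so \<open>a m\<close> is the sign usually written \<open>a\<^sub>m\<^sub>+\<^sub>1\<close> and it is multiplied by
  \<open>l\<^sup>m\<close>. The definition is meaningful for \<open>0 < l < 1\<close>; outside \<open>(-1, 1)\<close> the series diverges.
\<close>

definition sign_space :: "(nat \<Rightarrow> real) measure" where
  "sign_space = (\<Pi>\<^sub>M m\<in>UNIV. uniform_count_measure {-1, 1})"

definition bernoulli_convolution :: "real \<Rightarrow> real measure" where
  "bernoulli_convolution l = distr sign_space borel (\<lambda>a. \<Sum>m. a m * l ^ m)"

definition holder_continuous :: "real \<Rightarrow> (real \<Rightarrow> real) \<Rightarrow> bool" where
  "holder_continuous \<alpha> f \<longleftrightarrow>
     0 < \<alpha> \<and> \<alpha> \<le> 1 \<and> (\<exists>C. \<forall>x y. \<bar>f x - f y\<bar> \<le> C * \<bar>x - y\<bar> powr \<alpha>)"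

text \<open>
  A finite family of non-overlapping subintervals of \<open>I\<close> is encoded as the finite set \<open>P\<close> of
  its pairs of endpoints.
\<close>

definition absolutely_continuous_on :: "real set \<Rightarrow> (real \<Rightarrow> real) \<Rightarrow> bool" where
  "absolutely_continuous_on I f \<longleftrightarrow>
     (\<forall>e>0. \<exists>\<delta>>0. \<forall>P. finite P \<longrightarrow>
        (\<forall>(u, v)\<in>P. u < v \<and> {u..v} \<subseteq> I) \<longrightarrow>
        disjoint_family_on (\<lambda>(u, v). {u<..<v}) P \<longrightarrow>
        (\<Sum>(u, v)\<in>P. v - u) < \<delta> \<longrightarrow>
        (\<Sum>(u, v)\<in>P. \<bar>f v - f u\<bar>) < e)"

lemma prob_space_sign_space: "prob_space sign_space"
  unfolding sign_space_def
  by (intro prob_space_PiM prob_space_uniform_count_measure) auto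

lemma space_sign_space: "space sign_space = UNIV \<rightarrow> {-1, 1}"
  by (simp add: sign_space_def space_PiM space_uniform_count_measure PiE_def extensional_def)

lemma measurable_bernoulli_series:
  "(\<lambda>a. \<Sum>m. a m * l ^ m) \<in> borel_measurable sign_space" for l :: real
proof -
  have "(\<lambda>a. a m) \<in> borel_measurable sign_space" for m
  proof -
    have "(\<lambda>a. a m) \<in> measurable sign_space (uniform_count_measure {-1, 1})"
      unfolding sign_space_def by (rule measurable_component_singleton) simp
    moreover have "(\<lambda>x. x) \<in> borel_measurable (uniform_count_measure {-1, 1 :: real})"
      by (auto simp: measurable_def space_uniform_count_measure sets_uniform_count_measure)
    ultimately show ?thesis
      by (rule measurable_compose)
  qed
  then show ?thesis
    by (intro borel_measurable_suminf borel_measurable_times) auto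
qed

lemma prob_space_bernoulli_convolution: "prob_space (bernoulli_convolution l)"
  unfolding bernoulli_convolution_def
  by (rule prob_space.prob_space_distr[OF prob_space_sign_space measurable_bernoulli_series])

end

theory Submission
  imports Defs
begin

text \<open>
  Write \<open>X\<close> for the random series at the parameter \<open>\<lambda>\<close> and \<open>X'\<close> for its derivative in \<open>\<lambda>\<close>.
  Decompose \<open>\<phi>\<close> dyadically by mollifying with tent functions of width \<open>\<eta> = 2\<^sup>-\<^sup>j\<close>. If \<open>d\<close> is one of the
  pieces, then \<open>\<lambda> \<mapsto> E d(X)\<close> has derivative \<open>E d'(X) X'\<close>, and its \<open>L\<^sup>1\<close> norm has to be summable in \<open>j\<close>.
  Since \<open>d'\<close> is the convolution of a function of size \<open>\<eta>\<^sup>\<alpha>\<close> with a Haar function (scaled by \<open>\<eta>\<^sup>-\<^sup>2\<close>),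
  the Cauchy-Schwarz inequality reduces this to a bound for \<open>\<integral> E X' Y' T(X - Y) d\<lambda>\<close>, where \<open>Y\<close> is a
  copy of \<open>X\<close> and \<open>T\<close>, the autocorrelation of the Haar function, is minus the second derivative of
  a cubic B-spline.

  Choose \<open>k\<close> such that \<open>\<lambda>\<^sup>k\<close> lies between a number exceeding \<open>1/2\<close> and \<open>0.6\<close>; for \<open>\<lambda> > 2\<^sup>-\<^sup>1\<^sup>/\<^sup>3\<close> this
  is possible with \<open>k \<ge> 3\<close>. Condition on the signs whose index is not divisible by \<open>k\<close>, so that
  \<open>X - Y\<close> is a power series in \<open>\<beta> = \<lambda>\<^sup>k\<close> with coefficients in \<open>{-2, 0, 2}\<close>. Such series have no
  double zeros for \<open>\<beta> \<le> 0.61\<close>, so if the first difference of the signs occurs at \<open>\<beta>\<^sup>m\<close>, two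
  integrations by parts in \<open>\<lambda>\<close> gain the factor \<open>(\<eta> / \<beta>\<^sup>m)\<^sup>2\<close>. This event has probability
  \<open>2\<^sup>-\<^sup>m\<^sup>-\<^sup>1\<close>, and \<open>\<beta>\<^sup>1\<^sup>+\<^sup>s > 1/2\<close> for some \<open>s > 0\<close>, hence the total gain is \<open>\<eta>\<^sup>1\<^sup>+\<^sup>s\<close>, which
  compensates the loss from \<open>\<alpha> < 1\<close> as soon as \<open>1 - \<alpha>\<close> is small compared with \<open>s\<close>.
\<close>

section \<open>The autocorrelation of the Haar function\<close>

definition trunc_power :: "nat \<Rightarrow> real \<Rightarrow> real" where
  "trunc_power n u = (max 0 u) ^ n"

text \<open>Fourth central difference of a truncated power with step \<eta>; for
  \<open>n = 3\<close> it is a multiple of the cubic B-spline, and lower n give its derivatives up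
  to factors.\<close>

definition spline :: "nat \<Rightarrow> real \<Rightarrow> real \<Rightarrow> real" where
  "spline n \<eta> u = trunc_power n (u + 2 * \<eta>) - 4 * trunc_power n (u + \<eta>) + 6 * trunc_power n u
     - 4 * trunc_power n (u - \<eta>) + trunc_power n (u - 2 * \<eta>)"

definition tent :: "real \<Rightarrow> real \<Rightarrow> real" where
  "tent \<eta> u = max 0 (\<eta> - \<bar>u\<bar>)"

definition haar_corr :: "real \<Rightarrow> real \<Rightarrow> real" where
  "haar_corr \<eta> u = 2 * tent \<eta> u - tent \<eta> (u + \<eta>) - tent \<eta> (u - \<eta>)"

text \<open>Away from 0 this is the power rule. At 0 the difference quotient is a truncated power of
  exponent \<open>Suc n\<close>, which tends to 0; an exponent of at least 2 smooths the
  kink.\<close>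

lemma has_real_derivative_trunc_power:
  "(trunc_power (Suc (Suc n)) has_real_derivative real (n + 2) * trunc_power (Suc n) u) (at u)"
proof -
  consider "u < 0" | "u > 0" | "u = 0" by linarith
  then show ?thesis
  proof cases
    case 1
    have "((\<lambda>u. 0) has_real_derivative 0) (at u)" by simp
    then have "(trunc_power (Suc (Suc n)) has_real_derivative 0) (at u)"
      by (rule has_field_derivative_transform_within_open[where S = "{..<0}"])
        (use 1 in \<open>auto simp: trunc_power_def\<close>)
    then show ?thesis using 1 by (simp add: trunc_power_def)
  next
    case 2
    have "((\<lambda>u. u ^ Suc (Suc n)) has_real_derivative real (n + 2) * u ^ Suc n) (at u)"
      using DERIV_pow[of "Suc (Suc n)" u UNIV] by simp
    then have "(trunc_power (Suc (Suc n)) has_real_derivative real (n + 2) * u ^ Suc n) (at u)"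
      by (rule has_field_derivative_transform_within_open[where S = "{0<..}"])
        (use 2 in \<open>auto simp: trunc_power_def max_def\<close>)
    then show ?thesis using 2 by (simp add: trunc_power_def max_def)
  next
    case 3
    have "((\<lambda>h. max 0 h ^ Suc n :: real) \<longlongrightarrow> max 0 0 ^ Suc n) (at 0)"
      by (intro tendsto_intros)
    moreover have "\<forall>\<^sub>F h in at 0. (max 0 h) ^ Suc n = trunc_power (Suc (Suc n)) h / h"
      by (auto simp: eventually_at_filter trunc_power_def max_def power_0_left)
    ultimately have "((\<lambda>h. trunc_power (Suc (Suc n)) h / h) \<longlongrightarrow> 0) (at 0)"
      using Lim_transform_eventually by fastforce
    then show ?thesis using 3
      by (simp add: DERIV_def trunc_power_def)
  qed
qed

lemma has_real_derivative_spline: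
  "(spline (Suc (Suc n)) \<eta> has_real_derivative real (n + 2) * spline (Suc n) \<eta> u) (at u)"
proof -
  have *: "((\<lambda>u. trunc_power (Suc (Suc n)) (u + c)) has_real_derivative
      real (n + 2) * trunc_power (Suc n) (u + c)) (at u)" for c
    using has_real_derivative_trunc_power[of n "u + c"] by (simp add: DERIV_shift)
  show ?thesis
    unfolding spline_def[abs_def]
    using *[of "2 * \<eta>"] *[of \<eta>] *[of 0] *[of "- \<eta>"] *[of "- (2 * \<eta>)"]
    by (auto intro!: derivative_eq_intros simp: algebra_simps)
qed

text \<open>To the right of the support all truncated powers are true powers, and a fourth
  difference annihilates polynomials of degree at most 3; to the left all terms are 0.\<close>

lemma spline_eq_0:
  assumes "\<eta> > 0" "\<bar>u\<bar> \<ge> 2 * \<eta>" "n \<in> {1, 2, 3}"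
  shows "spline n \<eta> u = 0"
proof (cases "u \<ge> 0")
  case True
  then have "u \<ge> 2 * \<eta>" using assms by auto
  then have "max 0 (u + 2 * \<eta>) = u + 2 * \<eta>" "max 0 (u + \<eta>) = u + \<eta>" "max 0 u = u"
    "max 0 (u - \<eta>) = u - \<eta>" "max 0 (u - 2 * \<eta>) = u - 2 * \<eta>" using assms by auto
  then show ?thesis using assms(3) unfolding spline_def trunc_power_def
    by (auto simp: power2_eq_square power3_eq_cube algebra_simps)
next
  case False
  then have "u \<le> - 2 * \<eta>" using assms by auto
  then have "max 0 (u + 2 * \<eta>) = 0" "max 0 (u + \<eta>) = 0" "max 0 u = 0"
    "max 0 (u - \<eta>) = 0" "max 0 (u - 2 * \<eta>) = 0" using assms by auto
  then show ?thesis using assms(3) unfolding spline_def trunc_power_def by auto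
qed

lemma abs_spline_3_le:
  assumes "\<eta> > 0"
  shows "\<bar>spline 3 \<eta> u\<bar> \<le> 1200 * \<eta> ^ 3"
proof (cases "\<bar>u\<bar> \<ge> 2 * \<eta>")
  case True
  then show ?thesis using spline_eq_0[OF assms True, of 3] assms by simp
next
  case False
  \<comment> \<open>Inside the support u + c is below 4 \<eta>, whence the 64. The positive and the
    negative coefficients of the fourth difference each add up to 8, so 1200 is generous; divided by
    6 it becomes the 200 of the integral estimate.\<close>
  have *: "0 \<le> trunc_power 3 (u + c) \<and> trunc_power 3 (u + c) \<le> 64 * \<eta> ^ 3" if "c \<le> 2 * \<eta>" for c
  proof -
    have "max 0 (u + c) ^ 3 \<le> (4 * \<eta>) ^ 3"
      using False that assms by (intro power_mono) auto
    then show ?thesis by (simp add: trunc_power_def power_mult_distrib)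
  qed
  from *[of "2 * \<eta>"] *[of \<eta>] *[of 0] *[of "- \<eta>"] *[of "- (2 * \<eta>)"] assms
  have "0 \<le> trunc_power 3 (u + 2 * \<eta>)" "trunc_power 3 (u + 2 * \<eta>) \<le> 64 * \<eta> ^ 3"
    "0 \<le> trunc_power 3 (u + \<eta>)" "trunc_power 3 (u + \<eta>) \<le> 64 * \<eta> ^ 3"
    "0 \<le> trunc_power 3 u" "trunc_power 3 u \<le> 64 * \<eta> ^ 3"
    "0 \<le> trunc_power 3 (u - \<eta>)" "trunc_power 3 (u - \<eta>) \<le> 64 * \<eta> ^ 3"
    "0 \<le> trunc_power 3 (u - 2 * \<eta>)" "trunc_power 3 (u - 2 * \<eta>) \<le> 64 * \<eta> ^ 3"
    by auto
  then show ?thesis unfolding spline_def by linarith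
qed

lemma haar_corr_eq_spline: "\<eta> > 0 \<Longrightarrow> haar_corr \<eta> u = - spline 1 \<eta> u"
  unfolding haar_corr_def spline_def tent_def trunc_power_def by (auto simp: max_def abs_if)

lemma abs_haar_corr_le: "\<eta> > 0 \<Longrightarrow> \<bar>haar_corr \<eta> u\<bar> \<le> 4 * \<eta>"
  unfolding haar_corr_def tent_def by (auto simp: max_def abs_if)

section \<open>Haar functions and second differences\<close>

lemma has_integral_tent:
  fixes x y a b \<eta> :: real
  assumes "{x..x+\<eta>} \<subseteq> {a..b}"
  shows "((\<lambda>t. indicator {x..x+\<eta>} t * indicator {y..y+\<eta>} t) has_integral tent \<eta> (x - y)) {a..b}"
proof -
  \<comment> \<open>This is the overlap of the two intervals; it is empty exactly when |x - y| >
    \<eta>, where the tent vanishes.\<close>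
  have sub: "{max x y..min x y + \<eta>} \<subseteq> {a..b}" using assms by auto
  have "((\<lambda>t. 1::real) has_integral tent \<eta> (x - y)) {max x y..min x y + \<eta>}"
  proof (cases "max x y \<le> min x y + \<eta>")
    case True
    then show ?thesis using has_integral_const_real[of "1::real" "max x y" "min x y + \<eta>"]
      by (auto simp: tent_def max_def min_def abs_if algebra_simps split: if_splits)
  next
    case False
    then have "tent \<eta> (x - y) = 0" "{max x y..min x y + \<eta>} = {}" 
      by (auto simp: tent_def max_def min_def abs_if split: if_splits)
    then show ?thesis by auto
  qed
  then have "((\<lambda>t. if t \<in> {max x y..min x y + \<eta>} then 1::real else 0) has_integral tent \<eta> (x - y)) {a..b}"
    by (rule iffD2[OF has_integral_restrict[OF sub]])
  then show ?thesis
    by (rule has_integral_eq[rotated]) (auto simp: indicator_def)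
qed

text \<open>The left half keeps the shape \<open>{u..u+\<eta>}\<close> with u = x - \<eta>, so that
  both halves fall under the same interval lemmas.\<close>

definition haar :: "real \<Rightarrow> real \<Rightarrow> real \<Rightarrow> real" where
  "haar \<eta> x t = indicator {x..x+\<eta>} t - indicator {x-\<eta>..x-\<eta>+\<eta>} t"

lemma has_integral_haar_haar:
  assumes "\<eta> > 0" "a \<le> x - \<eta>" "x + \<eta> \<le> b"
  shows "((\<lambda>t. haar \<eta> x t * haar \<eta> y t) has_integral haar_corr \<eta> (x - y)) {a..b}"
proof -
  have s: "{x..x+\<eta>} \<subseteq> {a..b}" "{x-\<eta>..x-\<eta>+\<eta>} \<subseteq> {a..b}" using assms by auto
  have "((\<lambda>t. (indicator {x..x+\<eta>} t * indicator {y..y+\<eta>} t - indicator {x..x+\<eta>} t * indicator {y-\<eta>..y-\<eta>+\<eta>} t)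
      - (indicator {x-\<eta>..x-\<eta>+\<eta>} t * indicator {y..y+\<eta>} t - indicator {x-\<eta>..x-\<eta>+\<eta>} t * indicator {y-\<eta>..y-\<eta>+\<eta>} t))
     has_integral ((tent \<eta> (x - y) - tent \<eta> (x - (y - \<eta>))) - (tent \<eta> (x - \<eta> - y) - tent \<eta> (x - \<eta> - (y - \<eta>))))) {a..b}"
    by (intro has_integral_diff has_integral_tent s)
  then show ?thesis
    by (simp add: haar_def haar_corr_def algebra_simps)
qed

text \<open>By the fundamental theorem of calculus the two halves of the Haar function pick up the
  two first differences of \<open>E\<close>. Sums of second differences thereby become pairings of
  \<open>e\<close> with a combination of Haar functions, ready for Cauchy-Schwarz.\<close>

lemma has_integral_mult_haar:
  assumes e: "\<And>x. (E has_real_derivative e x) (at x)"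
    and "\<eta> > 0" "a \<le> x - \<eta>" "x + \<eta> \<le> b"
  shows "((\<lambda>t. e t * haar \<eta> x t) has_integral (E (x + \<eta>) - 2 * E x + E (x - \<eta>))) {a..b}"
proof -
  have *: "((\<lambda>t. e t * indicator {u..u+\<eta>} t) has_integral E (u + \<eta>) - E u) {a..b}"
    if "{u..u+\<eta>} \<subseteq> {a..b}" for u
  proof -
    have "(e has_integral E (u + \<eta>) - E u) {u..u+\<eta>}"
      using assms by (intro fundamental_theorem_of_calculus)
        (auto simp flip: has_real_derivative_iff_has_vector_derivative intro: e[THEN has_field_derivative_at_within])
    then have "((\<lambda>t. if t \<in> {u..u+\<eta>} then e t else 0) has_integral E (u + \<eta>) - E u) {a..b}"
      using has_integral_restrict[OF that] by blast
    then show ?thesis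
      by (rule has_integral_eq[rotated]) (auto simp: indicator_def)
  qed
  have s: "{x..x+\<eta>} \<subseteq> {a..b}" "{x-\<eta>..x-\<eta>+\<eta>} \<subseteq> {a..b}" using assms by auto
  have "((\<lambda>t. e t * indicator {x..x+\<eta>} t - e t * indicator {x-\<eta>..x-\<eta>+\<eta>} t) has_integral
     (E (x + \<eta>) - E x) - (E (x - \<eta> + \<eta>) - E (x - \<eta>))) {a..b}"
    by (intro has_integral_diff * s)
  then show ?thesis by (simp add: haar_def algebra_simps)
qed

text \<open>Cauchy-Schwarz in the parametrised form \<open>|F| \<le> F\<^sup>2/2t + t/2\<close>, which is linear in the
  quadratic form and so survives averaging and integration.\<close>

lemma abs_sum_second_difference_le:
  assumes e: "\<And>x. (E has_real_derivative e x) (at x)" and e0: "\<And>x. \<bar>e x\<bar> \<le> e0"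
    and "\<eta> > 0" "\<eta> \<le> 1" "t > 0" "finite I" and x: "\<And>i. i \<in> I \<Longrightarrow> \<bar>x i\<bar> \<le> B" and "B \<ge> 0"
  shows "\<bar>\<Sum>i\<in>I. c i * (E (x i + \<eta>) - 2 * E (x i) + E (x i - \<eta>))\<bar> \<le>
     e0 * ((\<Sum>i\<in>I. \<Sum>j\<in>I. c i * c j * haar_corr \<eta> (x i - x j)) / (2 * t) + t * (B + 1))"
proof -
  \<comment> \<open>Since \<eta> is at most 1, this interval contains the supports of all the Haar
    functions. Its length 2 (B + 1) times t / 2 is the last term of the bound.\<close>
  let ?a = "- B - 1" and ?b = "B + 1"
  define F where "F u = (\<Sum>i\<in>I. c i * haar \<eta> (x i) u)" for u
  have bd: "?a \<le> x i - \<eta>" "x i + \<eta> \<le> ?b" if "i \<in> I" for i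
    using x[OF that] assms by auto
  have "((\<lambda>u. \<Sum>i\<in>I. c i * (e u * haar \<eta> (x i) u)) has_integral
      (\<Sum>i\<in>I. c i * (E (x i + \<eta>) - 2 * E (x i) + E (x i - \<eta>)))) {?a..?b}"
    by (intro has_integral_sum has_integral_mult_right has_integral_mult_haar assms bd)
  then have 1: "((\<lambda>u. e u * F u) has_integral
      (\<Sum>i\<in>I. c i * (E (x i + \<eta>) - 2 * E (x i) + E (x i - \<eta>)))) {?a..?b}"
    by (simp add: F_def sum_distrib_left mult_ac)
  have "((\<lambda>u. \<Sum>i\<in>I. \<Sum>j\<in>I. (c i * c j) * (haar \<eta> (x i) u * haar \<eta> (x j) u)) has_integral
      (\<Sum>i\<in>I. \<Sum>j\<in>I. c i * c j * haar_corr \<eta> (x i - x j))) {?a..?b}"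
    by (intro has_integral_sum has_integral_mult_right has_integral_haar_haar assms bd)
  then have 2: "((\<lambda>u. F u * F u) has_integral
      (\<Sum>i\<in>I. \<Sum>j\<in>I. c i * c j * haar_corr \<eta> (x i - x j))) {?a..?b}"
    by (simp add: F_def sum_product mult_ac)
  have "((\<lambda>u. F u * F u / (2 * t) + t / 2) has_integral
      ((\<Sum>i\<in>I. \<Sum>j\<in>I. c i * c j * haar_corr \<eta> (x i - x j)) / (2 * t) + (?b - ?a) * (t / 2))) {?a..?b}"
    using has_integral_const_real[of "t/2" ?a ?b] assms
    by (intro has_integral_add has_integral_divide 2) (auto simp: algebra_simps)
  from has_integral_mult_right[OF this, of e0]
  have 3: "((\<lambda>u. e0 * (F u * F u / (2 * t) + t / 2)) has_integral
      e0 * ((\<Sum>i\<in>I. \<Sum>j\<in>I. c i * c j * haar_corr \<eta> (x i - x j)) / (2 * t) + t * (B + 1))) {?a..?b}"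
    by (simp add: algebra_simps)
  have *: "\<bar>e u * F u\<bar> \<le> e0 * (F u * F u / (2 * t) + t / 2)" for u
  proof -
    have "0 \<le> (\<bar>F u\<bar> - t)\<^sup>2" by simp
    then have "2 * t * \<bar>F u\<bar> \<le> F u * F u + t * t" by (simp add: power2_eq_square algebra_simps)
    then have "\<bar>F u\<bar> \<le> F u * F u / (2 * t) + t / 2" using assms by (simp add: field_simps)
    then show ?thesis unfolding abs_mult using e0[of u] by (intro mult_mono) auto
  qed
  have "\<bar>e u * F u\<bar> \<le> e0 * (F u * F u / (2 * t) + t / 2) \<Longrightarrow> - (e u * F u) \<le> e0 * (F u * F u / (2 * t) + t / 2)" for u
    by linarith
  then show ?thesis
    using has_integral_le[OF 1 3] has_integral_le[OF has_integral_neg[OF 1] 3] * 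
    by (meson abs_le_D1 abs_le_D2 abs_leI)
qed

text \<open>Two integrations by parts with respect to \<open>x d/dx\<close>. Where \<open>|D| > 2\<eta>\<close> the spline
  vanishes, so that the (junk) values of the quotients by \<open>D1\<close> do not matter there.\<close>

lemma abs_integral_haar_corr_le:
  fixes D D1 D2 D3 p p1 p2 :: "real \<Rightarrow> real"
  assumes ab: "0 < a" "a < b" and \<eta>: "\<eta> > 0"
    and D: "\<And>x. x > 0 \<Longrightarrow> (D has_real_derivative D1 x / x) (at x)"
    and D1: "\<And>x. x > 0 \<Longrightarrow> (D1 has_real_derivative D2 x / x) (at x)"
    and D2: "\<And>x. x > 0 \<Longrightarrow> (D2 has_real_derivative D3 x / x) (at x)"
    and p: "\<And>x. x > 0 \<Longrightarrow> (p has_real_derivative p1 x / x) (at x)"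
    and p1: "\<And>x. x > 0 \<Longrightarrow> (p1 has_real_derivative p2 x / x) (at x)"
    and 0: "p a = 0" "p b = 0" "p1 a = 0" "p1 b = 0"
    and V: "\<And>x. a \<le> x \<Longrightarrow> x \<le> b \<Longrightarrow> \<bar>D x\<bar> \<le> 2 * \<eta> \<Longrightarrow> D1 x \<noteq> 0 \<and>
       \<bar>p2 x / D1 x ^ 2 - 3 * p1 x * D2 x / D1 x ^ 3 - p x * D3 x / D1 x ^ 3
         + 3 * p x * D2 x ^ 2 / D1 x ^ 4\<bar> \<le> V"
    and "V \<ge> 0"
  shows "\<bar>integral {a..b} (\<lambda>x. haar_corr \<eta> (D x) * p x / x)\<bar> \<le> 200 * \<eta> ^ 3 * V * ((b - a) / a)"
proof -
  \<comment> \<open>Write T for x d/dx. Then \<open>U\<close> is T(p / D1) / D1 and \<open>W\<close>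
    is T U, the outcomes of one and two integrations by parts. \<open>\<Psi>\<close> collects the
    boundary terms of both; it vanishes at a and b with p and p1.\<close>
  define W where "W x = p2 x / D1 x ^ 2 - 3 * p1 x * D2 x / D1 x ^ 3 - p x * D3 x / D1 x ^ 3
         + 3 * p x * D2 x ^ 2 / D1 x ^ 4" for x
  define U where "U x = p1 x / D1 x ^ 2 - p x * D2 x / D1 x ^ 3" for x
  define \<Psi> where "\<Psi> x = spline 2 \<eta> (D x) / 2 * (p x / D1 x) - spline 3 \<eta> (D x) / 6 * U x" for x
  have S3: "(spline 3 \<eta> has_real_derivative 3 * spline 2 \<eta> u) (at u)" for u
    using has_real_derivative_spline[of 1 \<eta> u] by (simp add: numeral_eq_Suc)
  have S2: "(spline 2 \<eta> has_real_derivative 2 * spline 1 \<eta> u) (at u)" for u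
    using has_real_derivative_spline[of 0 \<eta> u] by (simp add: numeral_eq_Suc)
  have der: "(\<Psi> has_real_derivative (spline 1 \<eta> (D x) * p x - spline 3 \<eta> (D x) / 6 * W x) / x) (at x)"
    if x: "a \<le> x" "x \<le> b" for x
  proof (cases "\<bar>D x\<bar> \<le> 2 * \<eta>")
    case True
    have x0: "x > 0" using x ab by auto
    have nz: "D1 x \<noteq> 0" using V[OF x True] by auto
    have dU: "(U has_real_derivative W x / x) (at x)"
      unfolding U_def[abs_def] W_def using nz x0
      by (auto intro!: derivative_eq_intros D D1 D2 p p1 simp: field_simps power_numeral_reduce)
    have dq: "((\<lambda>x. p x / D1 x) has_real_derivative (D1 x * U x) / x) (at x)"
      unfolding U_def using nz x0
      by (auto intro!: derivative_eq_intros D1 p simp: field_simps power_numeral_reduce)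
    have d3: "((\<lambda>x. spline 3 \<eta> (D x)) has_real_derivative 3 * spline 2 \<eta> (D x) * (D1 x / x)) (at x)"
      by (rule DERIV_chain2[OF S3 D[OF x0]])
    have d2: "((\<lambda>x. spline 2 \<eta> (D x)) has_real_derivative 2 * spline 1 \<eta> (D x) * (D1 x / x)) (at x)"
      by (rule DERIV_chain2[OF S2 D[OF x0]])
    show ?thesis unfolding \<Psi>_def[abs_def]
      by (rule DERIV_cong[OF DERIV_diff[OF DERIV_mult[OF DERIV_cdivide[OF d2] dq]
          DERIV_mult[OF DERIV_cdivide[OF d3] dU]]]) (use nz x0 in \<open>auto simp: field_simps\<close>)
  next
    case False
    have x0: "x > 0" using x ab by auto
    have "isCont D x" using D[OF x0] DERIV_isCont by blast
    then have "((\<lambda>y. \<bar>D y\<bar>) \<longlongrightarrow> \<bar>D x\<bar>) (nhds x)"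
      by (intro tendsto_rabs) (simp add: isCont_def tendsto_at_iff_tendsto_nhds)
    then have "\<forall>\<^sub>F y in nhds x. 2 * \<eta> < \<bar>D y\<bar>"
      using False by (intro order_tendstoD) auto
    then have ev: "\<forall>\<^sub>F y in nhds x. \<Psi> y = 0"
      by eventually_elim (simp add: \<Psi>_def spline_eq_0[OF \<eta>])
    have "(\<Psi> has_real_derivative 0) (at x)"
      using DERIV_cong_ev[OF refl ev refl] by simp
    then show ?thesis using False \<eta> by (simp add: spline_eq_0)
  qed
  have "((\<lambda>x. (spline 1 \<eta> (D x) * p x - spline 3 \<eta> (D x) / 6 * W x) / x) has_integral \<Psi> b - \<Psi> a) {a..b}"
    by (rule fundamental_theorem_of_calculus)
      (use ab in \<open>auto simp only: atLeastAtMost_iff less_imp_le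
        simp flip: has_real_derivative_iff_has_vector_derivative
        intro!: der[THEN has_field_derivative_at_within]\<close>)
  moreover have "\<Psi> b = 0" "\<Psi> a = 0" using 0 by (auto simp: \<Psi>_def U_def)
  ultimately have I1: "((\<lambda>x. (spline 1 \<eta> (D x) * p x - spline 3 \<eta> (D x) / 6 * W x) / x) has_integral 0) {a..b}"
    by simp
  have cont: "continuous_on {a..b} D" "continuous_on {a..b} p"
    using ab by (auto intro!: continuous_at_imp_continuous_on DERIV_isCont[OF D] DERIV_isCont[OF p])
  have "(\<lambda>x. haar_corr \<eta> (D x) * p x / x) integrable_on {a..b}"
    using ab \<eta> unfolding haar_corr_def tent_def
    by (intro integrable_continuous_real continuous_intros cont) auto
  then have I2: "((\<lambda>x. haar_corr \<eta> (D x) * p x / x) has_integral integral {a..b} (\<lambda>x. haar_corr \<eta> (D x) * p x / x)) {a..b}"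
    (is "(_ has_integral ?I) _") by (rule integrable_integral)
  \<comment> \<open>As \<open>haar_corr\<close> is minus \<open>spline 1\<close>, adding the
    vanishing integral \<open>I1\<close> leaves only the cubic spline term, of size
    \<eta>^3.\<close>
  have I3: "((\<lambda>x. - (spline 3 \<eta> (D x) / 6 * W x / x)) has_integral ?I) {a..b}"
    using has_integral_add[OF I1 I2] ab \<eta>
    by (simp add: haar_corr_eq_spline diff_divide_distrib)
  have bd: "norm (- (spline 3 \<eta> (D x) / 6 * W x / x)) \<le> 200 * \<eta> ^ 3 * V / a" if "x \<in> {a..b}" for x
  proof (cases "\<bar>D x\<bar> \<le> 2 * \<eta>")
    case True
    have "\<bar>spline 3 \<eta> (D x) / 6\<bar> * \<bar>W x\<bar> / x \<le> (200 * \<eta> ^ 3) * V / a"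
      using that ab V[of x] True abs_spline_3_le[OF \<eta>, of "D x"] \<open>V \<ge> 0\<close> \<eta>
      by (intro frac_le mult_mono mult_nonneg_nonneg) (auto simp: W_def)
    then show ?thesis using that ab by (simp add: abs_mult)
  next
    case False
    then show ?thesis using \<eta> \<open>V \<ge> 0\<close> ab by (simp add: spline_eq_0)
  qed
  have "norm ?I \<le> (200 * \<eta> ^ 3 * V / a) * measure lborel (cbox a b)"
    using I3 bd \<open>V \<ge> 0\<close> \<eta> ab by (intro has_integral_bound[where f = "\<lambda>x. - (spline 3 \<eta> (D x) / 6 * W x / x)"]) auto
  then show ?thesis using ab by (simp add: algebra_simps)
qed

section \<open>Power series and transversality\<close>

lemma summable_poly_geometric:
  fixes q :: real
  assumes "0 \<le> q" "q < 1"
  shows "summable (\<lambda>p. (real p + 1) ^ r * q ^ p)"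
proof -
  have "(\<lambda>p. ((real p + 2) / (real p + 1)) ^ r * q) \<longlonglongrightarrow> 1 ^ r * q"
  proof (intro tendsto_intros)
    have "(\<lambda>p. 1 + inverse (real (Suc p))) \<longlonglongrightarrow> 1 + 0"
      by (intro tendsto_intros LIMSEQ_inverse_real_of_nat)
    then show "(\<lambda>p. (real p + 2) / (real p + 1)) \<longlonglongrightarrow> 1"
      by (simp add: field_simps)
  qed
  then have "\<forall>\<^sub>F p in sequentially. ((real p + 2) / (real p + 1)) ^ r * q < (1 + q) / 2"
    using assms by (intro order_tendstoD(2)) auto
  then obtain p0 where p0: "\<And>p. p \<ge> p0 \<Longrightarrow> ((real p + 2) / (real p + 1)) ^ r * q < (1 + q) / 2"
    by (auto simp: eventually_sequentially)
  show ?thesis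
  proof (rule summable_ratio_test)
    show "(1 + q) / 2 < 1" using assms by simp
    fix p assume "p \<ge> p0"
    have "(real (Suc p) + 1) ^ r * q ^ Suc p =
        (((real p + 2) / (real p + 1)) ^ r * q) * ((real p + 1) ^ r * q ^ p)"
      by (simp add: power_divide add_ac)
    also have "\<dots> \<le> (1 + q) / 2 * ((real p + 1) ^ r * q ^ p)"
      using p0[OF \<open>p \<ge> p0\<close>] assms by (intro mult_right_mono) auto
    finally show "norm ((real (Suc p) + 1) ^ r * q ^ Suc p) \<le> (1 + q) / 2 * norm ((real p + 1) ^ r * q ^ p)"
      using assms by (simp add: abs_mult)
  qed
qed

text \<open>The index \<open>r\<close> counts applications of \<open>x d/dx\<close>.\<close>

definition psum :: "nat \<Rightarrow> (nat \<Rightarrow> real) \<Rightarrow> nat \<Rightarrow> real \<Rightarrow> real" where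
  "psum N c r x = (\<Sum>i<N. c i * real i ^ r * x ^ i)"

text \<open>The exponent 3 serves every r up to 3 at once, because the base p + 1 is at least
  1.\<close>

definition cubic_series :: "real \<Rightarrow> real" where
  "cubic_series b = (\<Sum>p. (real p + 1) ^ 3 * b ^ p)"

lemma psum_diff: "psum N u r x - psum N v r x = psum N (\<lambda>i. u i - v i) r x"
  by (simp add: psum_def sum_subtractf algebra_simps)

lemma has_real_derivative_psum:
  assumes "x > 0"
  shows "(psum N c r has_real_derivative psum N c (Suc r) x / x) (at x)"
proof -
  have "((\<lambda>x. c i * real i ^ r * x ^ i) has_real_derivative c i * real i ^ Suc r * x ^ i / x) (at x)" for i
    using DERIV_cmult[OF DERIV_pow[of i x UNIV], of "c i * real i ^ r"] assms
    by (cases i) (auto simp: field_simps simp del: of_nat_Suc)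
  then show ?thesis
    unfolding psum_def[abs_def] sum_divide_distrib by (intro DERIV_sum)
qed

lemma cubic_series_ge_sum:
  assumes "0 \<le> b" "b < 1"
  shows "(\<Sum>p<n. (real p + 1) ^ 3 * b ^ p) \<le> cubic_series b"
  unfolding cubic_series_def using assms by (intro sum_le_suminf summable_poly_geometric) auto

lemma cubic_series_ge_1: "0 \<le> b \<Longrightarrow> b < 1 \<Longrightarrow> cubic_series b \<ge> 1"
  using cubic_series_ge_sum[of b 1] by simp

text \<open>Writing i = n + p, the inequality i <= (n + 1) (p + 1) separates the order of vanishing
  from the summation index: the factors (n + 1)^r and x^n come out, and the sum over p is majorised
  by the cubic series.\<close>

lemma abs_psum_le:
  assumes c: "\<And>i. \<bar>c i\<bar> \<le> A" "\<And>i. i < n \<Longrightarrow> c i = 0" and x: "0 \<le> x" "x \<le> b" "b < 1" and "r \<le> 3"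
  shows "\<bar>psum N c r x\<bar> \<le> A * (real n + 1) ^ r * x ^ n * cubic_series b"
proof -
  have A: "A \<ge> 0" using c(1)[of 0] by linarith
  have t: "\<bar>c i * real i ^ r * x ^ i\<bar> \<le> A * (real n + 1) ^ r * x ^ n * ((real (i - n) + 1) ^ 3 * b ^ (i - n))"
    if "i \<ge> n" for i
  proof -
    have "real i = real n + real (i - n)" using that by simp
    also have "\<dots> \<le> (real n + 1) * (real (i - n) + 1)" by (simp add: algebra_simps)
    finally have "real i ^ r \<le> ((real n + 1) * (real (i - n) + 1)) ^ r" by (intro power_mono) auto
    also have "\<dots> \<le> (real n + 1) ^ r * (real (i - n) + 1) ^ 3"
      unfolding power_mult_distrib using \<open>r \<le> 3\<close> by (intro mult_left_mono power_increasing) auto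
    finally have 1: "real i ^ r \<le> (real n + 1) ^ r * (real (i - n) + 1) ^ 3" .
    have 2: "x ^ i \<le> x ^ n * b ^ (i - n)"
    proof -
      have "x ^ i = x ^ n * x ^ (i - n)" using that by (simp flip: power_add)
      then show ?thesis using x by (simp add: mult_left_mono power_mono)
    qed
    have "\<bar>c i\<bar> * (real i ^ r * x ^ i) \<le> A * (((real n + 1) ^ r * (real (i - n) + 1) ^ 3) * (x ^ n * b ^ (i - n)))"
      using c(1)[of i] 1 2 x A by (intro mult_mono) auto
    then show ?thesis using x by (simp add: abs_mult mult_ac)
  qed
  have "\<bar>psum N c r x\<bar> \<le> (\<Sum>i<N. \<bar>c i * real i ^ r * x ^ i\<bar>)"
    unfolding psum_def by (rule sum_abs)
  also have "\<dots> = (\<Sum>i\<in>{n..<N}. \<bar>c i * real i ^ r * x ^ i\<bar>)"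
    using c(2) by (intro sum.mono_neutral_right) auto
  also have "\<dots> \<le> (\<Sum>i\<in>{n..<N}. A * (real n + 1) ^ r * x ^ n * ((real (i - n) + 1) ^ 3 * b ^ (i - n)))"
    using t by (intro sum_mono) auto
  also have "\<dots> = (\<Sum>p<N - n. A * (real n + 1) ^ r * x ^ n * ((real p + 1) ^ 3 * b ^ p))"
    by (subst sum.atLeastLessThan_shift_0) (simp add: atLeast0LessThan)
  also have "\<dots> = A * (real n + 1) ^ r * x ^ n * (\<Sum>p<N - n. (real p + 1) ^ 3 * b ^ p)"
    by (simp add: sum_distrib_left)
  also have "\<dots> \<le> A * (real n + 1) ^ r * x ^ n * cubic_series b"
    using x A by (intro mult_left_mono cubic_series_ge_sum) auto
  finally show ?thesis .
qed

lemma abs_psum_le':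
  assumes "\<And>i. \<bar>c i\<bar> \<le> 1" "0 \<le> x" "x \<le> b" "b < 1" "r \<le> 3"
  shows "\<bar>psum N c r x\<bar> \<le> cubic_series b"
  using abs_psum_le[of c 1 0 x b r N] assms by simp

text \<open>Subtracting \<open>m + 3\<close> times the series from its logarithmic derivative produces the factors
  \<open>l - m - 3\<close>, which are negative at the leading term and small at the next few, so that the leading
  term outweighs the sum of all the others up to \<open>\<beta> = 0.61\<close>.\<close>

lemma psum_transversal_pos:
  assumes g: "\<And>l. \<bar>g l\<bar> \<le> 2" "\<And>l. l < m \<Longrightarrow> g l = 0" "g m = 2" and "m < M"
    and \<beta>: "0 < \<beta>" "\<beta> \<le> 61/100"
  shows "psum M g 1 \<beta> - (real m + 3) * psum M g 0 \<beta> \<le> - (98/100) * \<beta> ^ m"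
proof -
  \<comment> \<open>Upper profile relative to the leading term: at p = 0 the exact negative
    contribution, at p > 0 the worst case |g| = 2 with an unfavourable sign.\<close>
  define v where "v p = (if p = 0 then - 3 else \<bar>real p - 3\<bar> * \<beta> ^ p)" for p :: nat
  have t: "(real l - real m - 3) * g l * \<beta> ^ l \<le> 2 * \<beta> ^ m * v (l - m)" if "l \<ge> m" for l
  proof (cases "l = m")
    case True
    then show ?thesis using g by (simp add: v_def)
  next
    case False
    have e: "real l - real m - 3 = real (l - m) - 3" using that by simp
    have "(real l - real m - 3) * g l \<le> \<bar>real (l - m) - 3\<bar> * \<bar>g l\<bar>"
      unfolding e by (metis abs_ge_self abs_mult)
    also have "\<dots> \<le> \<bar>real (l - m) - 3\<bar> * 2" using g by (intro mult_left_mono) auto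
    finally have "(real l - real m - 3) * g l * \<beta> ^ l \<le> \<bar>real (l - m) - 3\<bar> * 2 * \<beta> ^ l"
      using \<beta> by (intro mult_right_mono) auto
    also have "\<dots> = 2 * \<beta> ^ m * v (l - m)"
      using False that power_add[of \<beta> m "l - m"] by (simp add: v_def)
    finally show ?thesis .
  qed
  have "psum M g 1 \<beta> - (real m + 3) * psum M g 0 \<beta> = (\<Sum>l<M. (real l - real m - 3) * g l * \<beta> ^ l)"
    by (simp add: psum_def sum_distrib_left flip: sum_subtractf) (simp add: algebra_simps)
  also have "\<dots> = (\<Sum>l\<in>{m..<M}. (real l - real m - 3) * g l * \<beta> ^ l)"
    using g by (intro sum.mono_neutral_right) auto
  also have "\<dots> \<le> (\<Sum>l\<in>{m..<M}. 2 * \<beta> ^ m * v (l - m))"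
    using t by (intro sum_mono) auto
  also have "\<dots> = 2 * \<beta> ^ m * (\<Sum>p<M - m. v p)"
    by (subst sum.atLeastLessThan_shift_0) (simp add: atLeast0LessThan sum_distrib_left)
  \<comment> \<open>Padding with four further terms, all nonnegative because M > m, makes p = 0, 1,
    2, 3 available for every M. The term p = 3 vanishes, and those from p = 4 on form a
    differentiated geometric series.\<close>
  also have "(\<Sum>p<M - m. v p) \<le> (\<Sum>p<M - m + 4. v p)"
    using \<open>m < M\<close> \<beta> by (intro sum_mono2) (auto simp: v_def)
  also have "\<dots> = (\<Sum>p<4. v p) + (\<Sum>q<M - m. v (q + 4))"
    unfolding lessThan_atLeast0
    by (subst sum.atLeastLessThan_concat[of 0 4 "M - m + 4", symmetric])
      (auto simp: sum.atLeastLessThan_shift_0[of v 4] atLeast0LessThan add.commute)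
  also have "(\<Sum>p<4. v p) = - 3 + 2 * \<beta> + \<beta>\<^sup>2"
    by (simp add: v_def numeral_eq_Suc)
  also have "(\<Sum>q<M - m. v (q + 4)) = \<beta> ^ 4 * (\<Sum>q<M - m. real (Suc q) * \<beta> ^ q)"
    by (simp add: v_def sum_distrib_left power_add algebra_simps)
  also have "(\<Sum>q<M - m. real (Suc q) * \<beta> ^ q) \<le> 1 / (1 - \<beta>)\<^sup>2"
    using geometric_deriv_sums[of \<beta>] \<beta> sum_le_suminf[of "\<lambda>n. real (Suc n) * \<beta> ^ n" "{..<M - m}"]
    by (auto simp: sums_iff)
  \<comment> \<open>At \<beta> = 0.61 the left side is at most -3 + 1.22 + 0.3721 + 0.911, just
    below -0.49; the factor 2 \<beta>^m then gives the 98/100.\<close>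
  also have "- 3 + 2 * \<beta> + \<beta>\<^sup>2 + \<beta> ^ 4 * (1 / (1 - \<beta>)\<^sup>2) \<le> - 49/100"
  proof -
    have "\<beta>\<^sup>2 \<le> (61/100)\<^sup>2" "\<beta> ^ 4 \<le> (61/100) ^ 4" "(39/100)\<^sup>2 \<le> (1 - \<beta>)\<^sup>2"
      using \<beta> by (auto intro!: power_mono)
    moreover have "\<beta> ^ 4 / (1 - \<beta>)\<^sup>2 \<le> (61/100) ^ 4 / (39/100)\<^sup>2"
      by (rule frac_le) (use calculation in auto)
    moreover have "(61/100) ^ 4 / (39/100)\<^sup>2 \<le> (911/1000::real)" by (simp add: power_divide)
    ultimately have "\<beta> ^ 4 / (1 - \<beta>)\<^sup>2 \<le> 911/1000"
      by linarith
    then have "\<beta> ^ 4 * (1 / (1 - \<beta>)\<^sup>2) \<le> 911/1000" by simp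
    moreover have "\<beta>\<^sup>2 \<le> 3721/10000"
      using \<open>\<beta>\<^sup>2 \<le> (61/100)\<^sup>2\<close> by (simp add: power_divide)
    ultimately show ?thesis using \<beta> by linarith
  qed
  finally show ?thesis using \<beta> by (simp add: mult_left_mono)
qed

text \<open>Quantitative absence of double zeros. Where the series is small, its multiple by m + 3
  is at most 3/10 \<beta>^m, so the derivative retains 98/100 - 3/10, more than 1/2. A leading
  coefficient -2 is reduced to 2 by changing all signs.\<close>

lemma psum_transversal:
  assumes g: "\<And>l. \<bar>g l\<bar> \<le> 2" "\<And>l. l < m \<Longrightarrow> g l = 0" "\<bar>g m\<bar> = 2" and "m < M"
    and \<beta>: "0 < \<beta>" "\<beta> \<le> 61/100"
    and small: "\<bar>psum M g 0 \<beta>\<bar> \<le> \<beta> ^ m / (10 * (real m + 1))"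
  shows "\<bar>psum M g 1 \<beta>\<bar> \<ge> \<beta> ^ m / 2"
proof -
  have "(98/100) * \<beta> ^ m \<le> \<bar>psum M g 1 \<beta> - (real m + 3) * psum M g 0 \<beta>\<bar>"
  proof (cases "g m = 2")
    case True
    show ?thesis using psum_transversal_pos[of g m M \<beta>, OF g(1,2) True \<open>m < M\<close> \<beta>] by linarith
  next
    case False
    then have "g m = - 2" using g by auto
    then have "psum M (\<lambda>i. - g i) 1 \<beta> - (real m + 3) * psum M (\<lambda>i. - g i) 0 \<beta> \<le> - (98/100) * \<beta> ^ m"
      using g(1,2) \<open>m < M\<close> \<beta> by (intro psum_transversal_pos) auto
    moreover have "psum M (\<lambda>i. - g i) r \<beta> = - psum M g r \<beta>" for r
      by (simp add: psum_def sum_negf)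
    ultimately have "(real m + 3) * psum M g 0 \<beta> - psum M g 1 \<beta> \<le> - (98/100) * \<beta> ^ m" by simp
    then show ?thesis by linarith
  qed
  also have "\<dots> \<le> \<bar>psum M g 1 \<beta>\<bar> + (real m + 3) * \<bar>psum M g 0 \<beta>\<bar>"
    by (rule order_trans[OF abs_triangle_ineq4]) (simp add: abs_mult)
  also have "(real m + 3) * \<bar>psum M g 0 \<beta>\<bar> \<le> (3 * (real m + 1)) * (\<beta> ^ m / (10 * (real m + 1)))"
    using small by (intro mult_mono) auto
  also have "\<dots> = 3/10 * \<beta> ^ m" by (simp add: field_simps)
  finally show ?thesis by simp
qed

text \<open>A series in multiples of k is a series in x^k, and each x d/dx acts on it as k times the
  same operator in x^k.\<close>

lemma psum_multiples:
  assumes c: "\<And>i. c i \<noteq> 0 \<Longrightarrow> i \<in> (*) k ` {..<M}" and "k * M \<le> N" "k \<ge> 1"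
  shows "psum N c r x = real k ^ r * psum M (\<lambda>l. c (k * l)) r (x ^ k)"
proof -
  have sub: "(*) k ` {..<M} \<subseteq> {..<N}"
    using assms by (auto intro: less_le_trans[OF mult_strict_left_mono])
  have "psum N c r x = (\<Sum>i\<in>(*) k ` {..<M}. c i * real i ^ r * x ^ i)"
    unfolding psum_def using c sub by (intro sum.mono_neutral_right) auto
  also have "\<dots> = (\<Sum>l<M. c (k * l) * real (k * l) ^ r * x ^ (k * l))"
    using \<open>k \<ge> 1\<close> by (subst sum.reindex) (auto simp: inj_on_def)
  finally show ?thesis
    by (simp add: psum_def sum_distrib_left power_mult_distrib mult_ac flip: power_mult)
qed

text \<open>A set with minimum m is determined by its part in \<open>{m<..<M}\<close>, which leaves
  2^(M - m - 1) choices. G will be the set of places where two sign patterns differ, so this counts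
  pairs by their first difference.\<close>

lemma sum_Min_le:
  fixes g :: "nat \<Rightarrow> real"
  assumes "\<And>m. g m \<ge> 0"
  shows "(\<Sum>G\<in>Pow {..<M} - {{}}. g (Min G)) \<le> (\<Sum>m<M. 2 ^ (M - m - 1) * g m)"
proof -
  let ?A = "Pow {..<M} - {{}}"
  have Min: "Min G \<in> G" if "G \<in> ?A" for G
    using that finite_subset[of G "{..<M}"] by (intro Min_in) auto
  have "(\<Sum>G\<in>?A. g (Min G)) = (\<Sum>m<M. \<Sum>G\<in>{G\<in>?A. Min G = m}. g (Min G))"
    using Min by (intro sum.group[symmetric]) auto
  also have "\<dots> \<le> (\<Sum>m<M. 2 ^ (M - m - 1) * g m)"
  proof (rule sum_mono)
    fix m assume "m \<in> {..<M}"
    have "{G\<in>?A. Min G = m} \<subseteq> insert m ` Pow {m<..<M}"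
    proof
      fix G assume G: "G \<in> {G\<in>?A. Min G = m}"
      then have "m \<in> G" using Min by auto
      moreover have "G - {m} \<subseteq> {m<..<M}"
      proof
        fix i assume "i \<in> G - {m}"
        then have "Min G \<le> i" "i \<noteq> m" "i < M" using G finite_subset[of G "{..<M}"] by (auto intro!: Min_le)
        then show "i \<in> {m<..<M}" using G by auto
      qed
      ultimately show "G \<in> insert m ` Pow {m<..<M}" by (intro image_eqI[of _ _ "G - {m}"]) auto
    qed
    then have "card {G\<in>?A. Min G = m} \<le> card (insert m ` Pow {m<..<M})"
      by (intro card_mono) auto
    also have "\<dots> \<le> card (Pow {m<..<M})" by (intro card_image_le) auto
    also have "\<dots> = 2 ^ (M - m - 1)" by (simp add: card_Pow)
    finally have "real (card {G\<in>?A. Min G = m}) \<le> 2 ^ (M - m - 1)" 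
      by (metis of_nat_le_iff of_nat_numeral of_nat_power)
    then show "(\<Sum>G\<in>{G\<in>?A. Min G = m}. g (Min G)) \<le> 2 ^ (M - m - 1) * g m"
      using assms by (simp add: mult_right_mono)
  qed
  finally show ?thesis .
qed

section \<open>The energy estimate\<close>

text \<open>Here d1, d2 and d3 all have the scale y, so every quotient is of order 1 / y^2. With
  |d1| >= y / 2 the four terms contribute 4, 48, 16 and 192, which add up to 260.\<close>

lemma abs_parts_remainder_le:
  fixes p p1 p2 d1 d2 d3 y n Z P :: real
  assumes "y > 0" "\<bar>d1\<bar> \<ge> y / 2" "\<bar>d2\<bar> \<le> 2 * n ^ 2 * y * Z" "\<bar>d3\<bar> \<le> 2 * n ^ 3 * y * Z"
    and "\<bar>p\<bar> \<le> P" "\<bar>p1\<bar> \<le> P" "\<bar>p2\<bar> \<le> P" "n \<ge> 1" "Z \<ge> 1"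
  shows "\<bar>p2 / d1 ^ 2 - 3 * p1 * d2 / d1 ^ 3 - p * d3 / d1 ^ 3 + 3 * p * d2 ^ 2 / d1 ^ 4\<bar>
     \<le> 260 * Z ^ 2 * P * n ^ 4 / y ^ 2"
proof -
  have P: "P \<ge> 0" using assms by linarith
  have pw: "(y / 2) ^ j \<le> \<bar>d1\<bar> ^ j" for j using assms by (intro power_mono) auto
  have nn: "1 \<le> n ^ 4" "n ^ 2 \<le> n ^ 4" "n ^ 3 \<le> n ^ 4" "1 \<le> Z ^ 2" "Z \<le> Z ^ 2"
    using assms by (auto intro!: power_increasing simp: one_le_power self_le_power)
  let ?B = "P * (Z ^ 2 * n ^ 4) / y ^ 2"
  have z1: "1 \<le> Z ^ 2 * n ^ 4" using mult_mono[OF nn(4) nn(1)] by simp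
  have z2: "n ^ 2 * Z \<le> Z ^ 2 * n ^ 4" using mult_mono[OF nn(5) nn(2)] assms by (simp add: mult_ac)
  have z3: "n ^ 3 * Z \<le> Z ^ 2 * n ^ 4" using mult_mono[OF nn(5) nn(3)] assms by (simp add: mult_ac)
  have "\<bar>p2 / d1 ^ 2\<bar> \<le> P / (y / 2) ^ 2"
    unfolding abs_divide power_abs using assms pw[of 2] P by (intro frac_le) auto
  also have "\<dots> = 4 * (P * 1 / y ^ 2)" by (simp add: power_divide)
  also have "\<dots> \<le> 4 * ?B" using P assms z1 by (intro mult_left_mono divide_right_mono) auto
  finally have 1: "\<bar>p2 / d1 ^ 2\<bar> \<le> 4 * ?B" .
  have "\<bar>3 * p1 * d2 / d1 ^ 3\<bar> = 3 * (\<bar>p1\<bar> * \<bar>d2\<bar> / \<bar>d1\<bar> ^ 3)"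
    by (simp add: abs_mult power_abs)
  also have "\<dots> \<le> 3 * (P * (2 * n ^ 2 * y * Z) / (y / 2) ^ 3)"
    using assms pw[of 3] P by (intro mult_left_mono frac_le mult_mono mult_nonneg_nonneg) auto
  also have "\<dots> = 48 * (P * (n ^ 2 * Z) / y ^ 2)" using \<open>y > 0\<close> by (simp add: field_simps power_numeral_reduce)
  also have "\<dots> \<le> 48 * ?B" using P assms z2 by (intro mult_left_mono divide_right_mono) auto
  finally have 2: "\<bar>3 * p1 * d2 / d1 ^ 3\<bar> \<le> 48 * ?B" .
  have "\<bar>p * d3 / d1 ^ 3\<bar> = \<bar>p\<bar> * \<bar>d3\<bar> / \<bar>d1\<bar> ^ 3"
    by (simp add: abs_mult power_abs)
  also have "\<dots> \<le> P * (2 * n ^ 3 * y * Z) / (y / 2) ^ 3"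
    using assms pw[of 3] P by (intro mult_left_mono frac_le mult_mono mult_nonneg_nonneg) auto
  also have "\<dots> = 16 * (P * (n ^ 3 * Z) / y ^ 2)" using \<open>y > 0\<close> by (simp add: field_simps power_numeral_reduce)
  also have "\<dots> \<le> 16 * ?B" using P assms z3 by (intro mult_left_mono divide_right_mono) auto
  finally have 3: "\<bar>p * d3 / d1 ^ 3\<bar> \<le> 16 * ?B" .
  have "\<bar>3 * p * d2 ^ 2 / d1 ^ 4\<bar> = 3 * (\<bar>p\<bar> * \<bar>d2\<bar> ^ 2 / \<bar>d1\<bar> ^ 4)"
    by (simp add: abs_mult power_abs)
  also have "\<dots> \<le> 3 * (P * (2 * n ^ 2 * y * Z) ^ 2 / (y / 2) ^ 4)"
    using assms pw[of 4] P by (intro mult_left_mono frac_le mult_mono mult_nonneg_nonneg power_mono) auto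
  also have "\<dots> = 192 * ?B" using \<open>y > 0\<close> by (simp add: field_simps power_numeral_reduce)
  finally have 4: "\<bar>3 * p * d2 ^ 2 / d1 ^ 4\<bar> \<le> 192 * ?B" .
  have "260 * Z ^ 2 * P * n ^ 4 / y ^ 2 = 260 * ?B" by simp
  then show ?thesis using 1 2 3 4 by linarith
qed

text \<open>The polynomial ((x - a) (b - x))^2 suffices: its double zeros at both ends kill the
  boundary terms of two integrations by parts. \<psi>1 and \<psi>2 are its first and second images
  under x d/dx.\<close>

lemma cutoff_exists:
  fixes a a' b b' :: real
  assumes "0 < a" "a < a'" "a' \<le> b'" "b' < b"
  obtains \<psi> \<psi>1 \<psi>2 :: "real \<Rightarrow> real" and K \<kappa> :: real where
    "\<kappa> > 0" "\<And>x. x > 0 \<Longrightarrow> (\<psi> has_real_derivative \<psi>1 x / x) (at x)"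
    "\<And>x. x > 0 \<Longrightarrow> (\<psi>1 has_real_derivative \<psi>2 x / x) (at x)"
    "\<psi> a = 0" "\<psi> b = 0" "\<psi>1 a = 0" "\<psi>1 b = 0"
    "\<And>x. \<psi> x \<ge> 0" "\<And>x. x \<in> {a..b} \<Longrightarrow> \<bar>\<psi> x\<bar> \<le> K \<and> \<bar>\<psi>1 x\<bar> \<le> K \<and> \<bar>\<psi>2 x\<bar> \<le> K"
    "\<And>x. x \<in> {a'..b'} \<Longrightarrow> \<kappa> \<le> \<psi> x"
proof -
  define \<psi> :: "real \<Rightarrow> real" where "\<psi> = (\<lambda>x. ((x - a) * (b - x)) ^ 2)"
  define \<psi>1 :: "real \<Rightarrow> real" where "\<psi>1 = (\<lambda>x. 2 * x * ((x - a) * (b - x)) * (a + b - 2 * x))"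
  define \<psi>2 :: "real \<Rightarrow> real" where "\<psi>2 = (\<lambda>x. x * (2 * ((x - a) * (b - x)) * (a + b - 2 * x)
      + 2 * x * (a + b - 2 * x)\<^sup>2 - 4 * x * ((x - a) * (b - x))))"
  have "\<exists>K. \<forall>x\<in>{a..b}. \<bar>f x\<bar> \<le> K" if "continuous_on {a..b} f" for f :: "real \<Rightarrow> real"
    using compact_imp_bounded[OF compact_continuous_image[OF that]] by (auto simp: bounded_iff)
  note bdd = this
  have "continuous_on {a..b} \<psi>" "continuous_on {a..b} \<psi>1" "continuous_on {a..b} \<psi>2"
    unfolding \<psi>_def \<psi>1_def \<psi>2_def by (intro continuous_intros)+
  then obtain K0 K1 K2 where K: "\<forall>x\<in>{a..b}. \<bar>\<psi> x\<bar> \<le> K0" "\<forall>x\<in>{a..b}. \<bar>\<psi>1 x\<bar> \<le> K1" "\<forall>x\<in>{a..b}. \<bar>\<psi>2 x\<bar> \<le> K2"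
    using bdd by metis
  show ?thesis
  proof (rule that[of "((a' - a) * (b - b'))\<^sup>2" \<psi> \<psi>1 \<psi>2 "max K0 (max K1 K2)"])
    show "(\<psi> has_real_derivative \<psi>1 x / x) (at x)" if "x > 0" for x
      unfolding \<psi>_def \<psi>1_def using that by (auto intro!: derivative_eq_intros simp: field_simps)
    show "(\<psi>1 has_real_derivative \<psi>2 x / x) (at x)" if "x > 0" for x
      unfolding \<psi>1_def \<psi>2_def using that
      by (auto intro!: derivative_eq_intros simp: power2_eq_square field_simps)
    show "((a' - a) * (b - b'))\<^sup>2 \<le> \<psi> x" if "x \<in> {a'..b'}" for x
      unfolding \<psi>_def using that assms by (intro power_mono mult_mono) auto
  qed (use K assms in \<open>auto simp: \<psi>_def \<psi>1_def le_max_iff_disj\<close>)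
qed

text \<open>A range of parameters x on which x^k stays between b1 and the transversality limit
  61/100. The condition on s says that the probability 2^(-m) of a first difference at place m
  outweighs the loss b1^(-m (1 + s)) from dividing by the leading term. \<psi> is the
  cutoff.\<close>

locale window =
  fixes k :: nat and a b b1 s K :: real and \<psi> \<psi>1 \<psi>2 :: "real \<Rightarrow> real"
  assumes k: "k \<ge> 1" and ab: "0 < a" "a < b" "b < 1"
    and b1: "0 < b1" "b1 \<le> 1" "\<And>x. a \<le> x \<Longrightarrow> b1 \<le> x ^ k"
    and b: "\<And>x. 0 \<le> x \<Longrightarrow> x \<le> b \<Longrightarrow> x ^ k \<le> 61/100"
    and s: "0 < s" "s \<le> 1" "2 * b1 powr (1 + s) > 1"
    and \<psi>: "\<And>x. x > 0 \<Longrightarrow> (\<psi> has_real_derivative \<psi>1 x / x) (at x)"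
    and \<psi>1: "\<And>x. x > 0 \<Longrightarrow> (\<psi>1 has_real_derivative \<psi>2 x / x) (at x)"
    and \<psi>_ends: "\<psi> a = 0" "\<psi> b = 0" "\<psi>1 a = 0" "\<psi>1 b = 0"
    and \<psi>_ge: "\<And>x. \<psi> x \<ge> 0"
    and \<psi>_le: "\<And>x. x \<in> {a..b} \<Longrightarrow> \<bar>\<psi> x\<bar> \<le> K \<and> \<bar>\<psi>1 x\<bar> \<le> K \<and> \<bar>\<psi>2 x\<bar> \<le> K"
begin

abbreviation "Z \<equiv> cubic_series b"

text \<open>The 9 is the sum of the coefficients 1, 1, 1, 2, 2, 2 that arise on applying x d/dx
  twice to a product of three factors.\<close>

definition "weight_bound = 9 * K * Z ^ 2"

text \<open>Contribution of two sign sequences to the energy. The factors \<open>psum N u 1\<close>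
  and \<open>psum N v 1\<close> are x times the derivatives of the two sums; the quotient by x
  yields the measure dx / x, for which x d/dx integrates by parts without correction.\<close>

definition pair_integral :: "nat \<Rightarrow> real \<Rightarrow> (nat \<Rightarrow> real) \<Rightarrow> (nat \<Rightarrow> real) \<Rightarrow> real" where
  "pair_integral N \<eta> u v = integral {a..b} (\<lambda>x. haar_corr \<eta> (psum N u 0 x - psum N v 0 x) *
     (\<psi> x * psum N u 1 x * psum N v 1 x) / x)"

lemma K_nonneg: "K \<ge> 0"
  using \<psi>_le[of a] ab by auto

lemma Z_ge_1: "Z \<ge> 1"
  using cubic_series_ge_1 ab by auto

lemma weight_bound_nonneg: "weight_bound \<ge> 0"
  using K_nonneg by (simp add: weight_bound_def)

lemma continuous_on_psum: "continuous_on {a..b} (psum N c r)"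
  unfolding psum_def[abs_def] by (intro continuous_intros)

lemma continuous_on_\<psi>: "continuous_on {a..b} \<psi>"
  using ab by (auto intro!: continuous_at_imp_continuous_on DERIV_isCont[OF \<psi>])

lemma weight_bounds:
  assumes u: "\<And>i. \<bar>u i\<bar> \<le> 1" and v: "\<And>i. \<bar>v i\<bar> \<le> 1" and x: "x \<in> {a..b}"
  shows "\<bar>\<psi> x * psum N u 1 x * psum N v 1 x\<bar> \<le> weight_bound"
    and "\<bar>\<psi>1 x * psum N u 1 x * psum N v 1 x + \<psi> x * psum N u 2 x * psum N v 1 x
      + \<psi> x * psum N u 1 x * psum N v 2 x\<bar> \<le> weight_bound"
    and "\<bar>\<psi>2 x * psum N u 1 x * psum N v 1 x + \<psi> x * psum N u 3 x * psum N v 1 x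
      + \<psi> x * psum N u 1 x * psum N v 3 x + 2 * (\<psi>1 x * psum N u 2 x * psum N v 1 x)
      + 2 * (\<psi>1 x * psum N u 1 x * psum N v 2 x) + 2 * (\<psi> x * psum N u 2 x * psum N v 2 x)\<bar> \<le> weight_bound"
proof -
  have *: "\<bar>c * psum N u i x * psum N v j x\<bar> \<le> K * Z ^ 2" if "\<bar>c\<bar> \<le> K" "i \<le> 3" "j \<le> 3" for c i j
    unfolding power2_eq_square mult.assoc[symmetric] abs_mult
    using that abs_psum_le'[OF u, of x b i N] abs_psum_le'[OF v, of x b j N] x ab K_nonneg Z_ge_1
    by (intro mult_mono) auto
  have KZ: "K * Z ^ 2 \<ge> 0" using K_nonneg by simp
  note \<psi>x = \<psi>_le[OF x]
  show "\<bar>\<psi> x * psum N u 1 x * psum N v 1 x\<bar> \<le> weight_bound"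
    using *[of "\<psi> x" 1 1] \<psi>x KZ unfolding weight_bound_def by simp
  show "\<bar>\<psi>1 x * psum N u 1 x * psum N v 1 x + \<psi> x * psum N u 2 x * psum N v 1 x
      + \<psi> x * psum N u 1 x * psum N v 2 x\<bar> \<le> weight_bound"
    using *[of "\<psi>1 x" 1 1] *[of "\<psi> x" 2 1] *[of "\<psi> x" 1 2] \<psi>x KZ unfolding weight_bound_def by simp
  show "\<bar>\<psi>2 x * psum N u 1 x * psum N v 1 x + \<psi> x * psum N u 3 x * psum N v 1 x
      + \<psi> x * psum N u 1 x * psum N v 3 x + 2 * (\<psi>1 x * psum N u 2 x * psum N v 1 x)
      + 2 * (\<psi>1 x * psum N u 1 x * psum N v 2 x) + 2 * (\<psi> x * psum N u 2 x * psum N v 2 x)\<bar> \<le> weight_bound"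
    using *[of "\<psi>2 x" 1 1] *[of "\<psi> x" 3 1] *[of "\<psi> x" 1 3] *[of "\<psi>1 x" 2 1] *[of "\<psi>1 x" 1 2]
      *[of "\<psi> x" 2 2] \<psi>x KZ unfolding weight_bound_def by simp
qed

lemma pair_integral_trivial:
  assumes u: "\<And>i. \<bar>u i\<bar> \<le> 1" and v: "\<And>i. \<bar>v i\<bar> \<le> 1" and "\<eta> > 0"
  shows "\<bar>pair_integral N \<eta> u v\<bar> \<le> 4 * \<eta> * weight_bound * ((b - a) / a)"
proof -
  have "\<bar>haar_corr \<eta> (psum N u 0 x - psum N v 0 x) * (\<psi> x * psum N u 1 x * psum N v 1 x) / x\<bar> \<le> 4 * \<eta> * weight_bound / a"
    if x: "x \<in> {a..b}" for x
    unfolding abs_divide abs_mult[of "haar_corr _ _"]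
    using weight_bounds(1)[OF u v x] abs_haar_corr_le[OF \<open>\<eta> > 0\<close>] x ab \<open>\<eta> > 0\<close> weight_bound_nonneg
    by (intro frac_le mult_mono mult_nonneg_nonneg) auto
  moreover have "(\<lambda>x. haar_corr \<eta> (psum N u 0 x - psum N v 0 x) *
     (\<psi> x * psum N u 1 x * psum N v 1 x) / x) integrable_on {a..b}"
    unfolding haar_corr_def tent_def using ab
    by (intro integrable_continuous_real continuous_intros continuous_on_psum continuous_on_\<psi>) auto
  then have "((\<lambda>x. haar_corr \<eta> (psum N u 0 x - psum N v 0 x) *
     (\<psi> x * psum N u 1 x * psum N v 1 x) / x) has_integral pair_integral N \<eta> u v) (cbox a b)"
    unfolding pair_integral_def by (simp add: integrable_integral)
  ultimately have "norm (pair_integral N \<eta> u v) \<le> (4 * \<eta> * weight_bound / a) * measure lborel (cbox a b)"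
    using \<open>\<eta> > 0\<close> weight_bound_nonneg ab by (intro has_integral_bound) auto
  then show ?thesis using ab by simp
qed

text \<open>The difference of the two sums is a series in x^k starting at (x^k)^m. By
  \<open>small\<close>, wherever it lies within the support of the spline it is small enough for
  transversality, so the integration by parts applies. The remainder is bounded with y = x^(k m), at
  least b1^m, and n = k (m + 1).\<close>

lemma pair_integral_parts:
  fixes m M N :: nat
  assumes u: "\<And>i. \<bar>u i\<bar> \<le> 1" and v: "\<And>i. \<bar>v i\<bar> \<le> 1" and "\<eta> > 0"
    and m: "m < M" and N: "k * M \<le> N"
    and supp: "\<And>i. u i \<noteq> v i \<Longrightarrow> i \<in> (*) k ` {m..<M}" and lead: "\<bar>u (k * m) - v (k * m)\<bar> = 2"
    and small: "2 * \<eta> \<le> b1 ^ m / (10 * (real m + 1))"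
  shows "\<bar>pair_integral N \<eta> u v\<bar> \<le>
     200 * \<eta> ^ 3 * (260 * Z ^ 2 * weight_bound * (real k * (real m + 1)) ^ 4 / (b1 ^ m)\<^sup>2) * ((b - a) / a)"
proof -
  define c where "c i = u i - v i" for i
  have cle: "\<bar>c i\<bar> \<le> 2" for i using u[of i] v[of i] unfolding c_def by linarith
  have c0: "c i = 0" if "i < k * m" for i
  proof (rule ccontr)
    assume "c i \<noteq> 0"
    then have "u i \<noteq> v i" by (simp add: c_def)
    then obtain l where "i = k * l" "l \<in> {m..<M}" using supp by blast
    then show False using that by auto
  qed
  have cs: "c i \<noteq> 0 \<Longrightarrow> i \<in> (*) k ` {..<M}" for i
    using supp[of i] by (auto simp: c_def)
  have n1: "real (k * m) + 1 \<le> real k * (real m + 1)" using k by (simp add: algebra_simps)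
  show ?thesis
    unfolding pair_integral_def psum_diff c_def[symmetric]
  proof (rule abs_integral_haar_corr_le[where ?D1.0 = "psum N c 1" and ?D2.0 = "psum N c 2" and ?D3.0 = "psum N c 3"
        and ?p1.0 = "\<lambda>x. \<psi>1 x * psum N u 1 x * psum N v 1 x + \<psi> x * psum N u 2 x * psum N v 1 x
            + \<psi> x * psum N u 1 x * psum N v 2 x"
        and ?p2.0 = "\<lambda>x. \<psi>2 x * psum N u 1 x * psum N v 1 x + \<psi> x * psum N u 3 x * psum N v 1 x
            + \<psi> x * psum N u 1 x * psum N v 3 x + 2 * (\<psi>1 x * psum N u 2 x * psum N v 1 x)
            + 2 * (\<psi>1 x * psum N u 1 x * psum N v 2 x) + 2 * (\<psi> x * psum N u 2 x * psum N v 2 x)"])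
    fix x :: real assume x: "x > 0"
    have d: "(psum N w 0 has_real_derivative psum N w 1 x / x) (at x)"
      "(psum N w 1 has_real_derivative psum N w 2 x / x) (at x)"
      "(psum N w 2 has_real_derivative psum N w 3 x / x) (at x)" for w
      using has_real_derivative_psum[OF x, of N w 0] has_real_derivative_psum[OF x, of N w 1]
        has_real_derivative_psum[OF x, of N w 2] by (simp_all add: numeral_eq_Suc)
    show "(psum N c 0 has_real_derivative psum N c 1 x / x) (at x)"
      "(psum N c 1 has_real_derivative psum N c 2 x / x) (at x)"
      "(psum N c 2 has_real_derivative psum N c 3 x / x) (at x)" by (fact d)+
    show "((\<lambda>x. \<psi> x * psum N u 1 x * psum N v 1 x) has_real_derivative
       (\<psi>1 x * psum N u 1 x * psum N v 1 x + \<psi> x * psum N u 2 x * psum N v 1 x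
            + \<psi> x * psum N u 1 x * psum N v 2 x) / x) (at x)"
      by (rule DERIV_cong[OF DERIV_mult[OF DERIV_mult[OF \<psi>[OF x] d(2)] d(2)]])
        (use x in \<open>simp add: field_simps\<close>)
    have t: "((\<lambda>x. f x * psum N u i x * psum N v j x) has_real_derivative
       (f' * psum N u i x * psum N v j x + f x * psum N u (Suc i) x * psum N v j x
            + f x * psum N u i x * psum N v (Suc j) x) / x) (at x)"
      if "(f has_real_derivative f' / x) (at x)" for f f' i j
      by (rule DERIV_cong[OF DERIV_mult[OF DERIV_mult[OF that has_real_derivative_psum[OF x]]
          has_real_derivative_psum[OF x]]]) (use x in \<open>simp add: field_simps\<close>)
    show "((\<lambda>x. \<psi>1 x * psum N u 1 x * psum N v 1 x + \<psi> x * psum N u 2 x * psum N v 1 x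
            + \<psi> x * psum N u 1 x * psum N v 2 x) has_real_derivative
       (\<psi>2 x * psum N u 1 x * psum N v 1 x + \<psi> x * psum N u 3 x * psum N v 1 x
            + \<psi> x * psum N u 1 x * psum N v 3 x + 2 * (\<psi>1 x * psum N u 2 x * psum N v 1 x)
            + 2 * (\<psi>1 x * psum N u 1 x * psum N v 2 x) + 2 * (\<psi> x * psum N u 2 x * psum N v 2 x)) / x) (at x)"
      by (rule DERIV_cong[OF DERIV_add[OF DERIV_add[OF t[OF \<psi>1[OF x]] t[OF \<psi>[OF x]]] t[OF \<psi>[OF x]]]])
        (simp add: numeral_eq_Suc add_divide_distrib mult_ac)
  next
    fix x assume x: "a \<le> x" "x \<le> b" and D: "\<bar>psum N c 0 x\<bar> \<le> 2 * \<eta>"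
    have x0: "0 < x" using x ab by auto
    define y where "y = x ^ (k * m)"
    have y0: "y > 0" using x0 by (simp add: y_def)
    have yb: "b1 ^ m \<le> y" unfolding y_def power_mult using b1 x by (intro power_mono) auto
    have pm: "psum N c r x = real k ^ r * psum M (\<lambda>l. c (k * l)) r (x ^ k)" for r
      using psum_multiples[of c k M N] cs N k by blast
    have "\<bar>psum M (\<lambda>l. c (k * l)) 0 (x ^ k)\<bar> \<le> b1 ^ m / (10 * (real m + 1))"
      using D pm[of 0] small by simp
    also have "\<dots> \<le> (x ^ k) ^ m / (10 * (real m + 1))"
      using yb by (intro divide_right_mono) (auto simp: y_def power_mult)
    finally have "\<bar>psum M (\<lambda>l. c (k * l)) 1 (x ^ k)\<bar> \<ge> (x ^ k) ^ m / 2"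
      using cle c0 lead m x0 x b[of x] k
      by (intro psum_transversal) (auto simp: c_def)
    then have "real k * ((x ^ k) ^ m / 2) \<le> real k * \<bar>psum M (\<lambda>l. c (k * l)) 1 (x ^ k)\<bar>"
      by (rule mult_left_mono) simp
    then have "real k * ((x ^ k) ^ m / 2) \<le> \<bar>psum N c 1 x\<bar>"
      unfolding pm[of 1] abs_mult by simp
    moreover have "1 * ((x ^ k) ^ m / 2) \<le> real k * ((x ^ k) ^ m / 2)"
      using k x0 by (intro mult_right_mono) auto
    ultimately have D1: "y / 2 \<le> \<bar>psum N c 1 x\<bar>" by (simp add: y_def power_mult)
    have Dr: "\<bar>psum N c r x\<bar> \<le> 2 * (real k * (real m + 1)) ^ r * y * Z" if "r \<le> 3" for r
    proof -
      have "\<bar>psum N c r x\<bar> \<le> 2 * (real (k * m) + 1) ^ r * y * Z"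
        unfolding y_def using cle c0 x x0 ab that by (intro abs_psum_le) auto
      also have "\<dots> \<le> 2 * (real k * (real m + 1)) ^ r * y * Z"
        using n1 y0 Z_ge_1 by (intro mult_right_mono mult_left_mono power_mono) auto
      finally show ?thesis .
    qed
    have Dr2: "\<bar>psum N c 2 x\<bar> \<le> 2 * (real k * (real m + 1)) ^ 2 * y * Z"
      and Dr3: "\<bar>psum N c 3 x\<bar> \<le> 2 * (real k * (real m + 1)) ^ 3 * y * Z"
      by (rule Dr, simp)+
    have xx: "x \<in> {a..b}" using x by simp
    have n: "real k * (real m + 1) \<ge> 1" using n1 by (simp add: order_trans[rotated])
    note wb = weight_bounds(1)[of u v x N, OF u v xx] weight_bounds(2)[of u v x N, OF u v xx]
      weight_bounds(3)[of u v x N, OF u v xx]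
    have "260 * Z ^ 2 * weight_bound * (real k * (real m + 1)) ^ 4 / y\<^sup>2 \<le> 260 * Z ^ 2 * weight_bound * (real k * (real m + 1)) ^ 4 / (b1 ^ m)\<^sup>2"
      using yb b1 y0 weight_bound_nonneg by (intro divide_left_mono power_mono mult_pos_pos mult_nonneg_nonneg) auto
    note order_trans[OF abs_parts_remainder_le[OF y0 D1 Dr2 Dr3 wb n Z_ge_1] this]
    moreover have "psum N c 1 x \<noteq> 0" using y0 D1 by auto
    ultimately
    show "psum N c 1 x \<noteq> 0 \<and>
       \<bar>(\<psi>2 x * psum N u 1 x * psum N v 1 x + \<psi> x * psum N u 3 x * psum N v 1 x
            + \<psi> x * psum N u 1 x * psum N v 3 x + 2 * (\<psi>1 x * psum N u 2 x * psum N v 1 x)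
            + 2 * (\<psi>1 x * psum N u 1 x * psum N v 2 x) + 2 * (\<psi> x * psum N u 2 x * psum N v 2 x)) / psum N c 1 x ^ 2 -
        3 * (\<psi>1 x * psum N u 1 x * psum N v 1 x + \<psi> x * psum N u 2 x * psum N v 1 x
            + \<psi> x * psum N u 1 x * psum N v 2 x) * psum N c 2 x / psum N c 1 x ^ 3 -
        (\<psi> x * psum N u 1 x * psum N v 1 x) * psum N c 3 x / psum N c 1 x ^ 3 +
        3 * (\<psi> x * psum N u 1 x * psum N v 1 x) * psum N c 2 x ^ 2 / psum N c 1 x ^ 4\<bar>
       \<le> 260 * Z ^ 2 * weight_bound * (real k * (real m + 1)) ^ 4 / (b1 ^ m)\<^sup>2"
      by (intro conjI)
  qed (use ab \<psi>_ends \<open>\<eta> > 0\<close> weight_bound_nonneg in auto)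
qed

text \<open>The first summand serves the range of integration by parts, the second (1600 = 4 * 400)
  that of the trivial bound.\<close>

definition "pair_const = (200 * 260 * Z ^ 2 * weight_bound * real k ^ 4 + 1600 * weight_bound) * ((b - a) / a)"

lemma pair_const_nonneg: "pair_const \<ge> 0"
  unfolding pair_const_def using weight_bound_nonneg ab by (intro mult_nonneg_nonneg add_nonneg_nonneg) auto

text \<open>Put y = \<eta> / b1^m. If y is small, integration by parts gives y^2, which is at most
  y^(1 + s) as y <= 1. Otherwise y is at least of order 1 / (m + 1), and the trivial bound suffices
  at the price of a power of m + 1.\<close>

lemma abs_pair_integral_le:
  fixes m M N :: nat
  assumes u: "\<And>i. \<bar>u i\<bar> \<le> 1" and v: "\<And>i. \<bar>v i\<bar> \<le> 1" and \<eta>: "\<eta> > 0"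
    and m: "m < M" and N: "k * M \<le> N"
    and supp: "\<And>i. u i \<noteq> v i \<Longrightarrow> i \<in> (*) k ` {m..<M}" and lead: "\<bar>u (k * m) - v (k * m)\<bar> = 2"
  shows "\<bar>pair_integral N \<eta> u v\<bar> \<le> pair_const * \<eta> * (real m + 1) ^ 4 * (\<eta> / b1 ^ m) powr (1 + s)"
proof -
  define y where "y = \<eta> / b1 ^ m"
  have y: "y > 0" using \<eta> b1 by (simp add: y_def)
  have pq: "0 \<le> 260 * Z ^ 2 * weight_bound * real k ^ 4" "0 \<le> weight_bound" "0 \<le> (b - a) / a" using weight_bound_nonneg ab by auto
  show ?thesis
  proof (cases "2 * \<eta> \<le> b1 ^ m / (10 * (real m + 1))")
    case True
    have "b1 ^ m / (10 * (real m + 1)) \<le> b1 ^ m / 1" using b1 by (intro divide_left_mono) auto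
    then have "\<eta> \<le> b1 ^ m" using True \<eta> by linarith
    then have "y \<le> 1" using b1 by (simp add: y_def)
    then have "y powr 2 \<le> y powr (1 + s)" using y s by (intro powr_mono') auto
    then have y2: "y\<^sup>2 \<le> y powr (1 + s)" using y by simp
    have "\<bar>pair_integral N \<eta> u v\<bar> \<le> 200 * \<eta> ^ 3 * (260 * Z ^ 2 * weight_bound * (real k * (real m + 1)) ^ 4 / (b1 ^ m)\<^sup>2) * ((b - a) / a)"
      by (rule pair_integral_parts[of u v \<eta> m M N, OF u v \<eta> m N supp lead True])
    also have "\<dots> = (200 * 260 * Z ^ 2 * weight_bound * real k ^ 4) * ((b - a) / a) * \<eta> * (real m + 1) ^ 4 * y\<^sup>2"
      by (simp add: y_def power_mult_distrib power_divide power2_eq_square power3_eq_cube mult_ac)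
    also have "\<dots> \<le> pair_const * \<eta> * (real m + 1) ^ 4 * y powr (1 + s)"
      unfolding pair_const_def using pq \<eta> y2 
      by (intro mult_mono mult_nonneg_nonneg add_nonneg_nonneg) auto
    finally show ?thesis by (simp add: y_def)
  next
    case False
    \<comment> \<open>Failure of the smallness condition says precisely that 20 (m + 1) y exceeds 1;
      its power 1 + s, with s <= 1, costs at most 400 (m + 1)^2.\<close>
    then have "1 \<le> 20 * (real m + 1) * y" using b1 \<eta> by (simp add: y_def field_simps)
    then have "1 \<le> (20 * (real m + 1) * y) powr (1 + s)" using s by (intro ge_one_powr_ge_zero) auto
    also have "\<dots> = (20 * (real m + 1)) powr (1 + s) * y powr (1 + s)" by (rule powr_mult)
    also have "\<dots> \<le> (20 * (real m + 1)) powr 2 * y powr (1 + s)"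
      using s by (intro mult_right_mono powr_mono) auto
    also have "\<dots> = 400 * (real m + 1) ^ 2 * y powr (1 + s)"
      by (simp add: power2_eq_square algebra_simps)
    also have "\<dots> \<le> 400 * (real m + 1) ^ 4 * y powr (1 + s)"
      by (intro mult_right_mono mult_left_mono power_increasing) auto
    finally have 1: "1 \<le> 400 * ((real m + 1) ^ 4 * y powr (1 + s))" by simp
    have "\<bar>pair_integral N \<eta> u v\<bar> \<le> 4 * \<eta> * weight_bound * ((b - a) / a) * 1"
      using pair_integral_trivial[OF u v \<eta>] by simp
    also have "\<dots> \<le> 4 * \<eta> * weight_bound * ((b - a) / a) * (400 * ((real m + 1) ^ 4 * y powr (1 + s)))"
      using 1 pq \<eta> by (intro mult_left_mono mult_nonneg_nonneg) auto
    also have "\<dots> = (1600 * weight_bound) * ((b - a) / a) * \<eta> * (real m + 1) ^ 4 * y powr (1 + s)" by simp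
    also have "\<dots> \<le> pair_const * \<eta> * (real m + 1) ^ 4 * y powr (1 + s)"
      unfolding pair_const_def using pq \<eta> by (intro mult_right_mono) auto
    finally show ?thesis by (simp add: y_def)
  qed
qed

end

section \<open>Sign patterns, encoded by the set of indices with sign +1\<close>

definition sg :: "nat set \<Rightarrow> nat \<Rightarrow> real" where
  "sg S i = (if i \<in> S then 1 else -1)"

text \<open>In this encoding, reversing the signs at the places k E is a symmetric difference, hence
  an involution on patterns.\<close>

definition flip :: "nat \<Rightarrow> nat set \<Rightarrow> nat set \<Rightarrow> nat set" where
  "flip k S E = sym_diff S ((*) k ` E)"

lemma abs_sg: "\<bar>sg S i\<bar> \<le> 1"
  by (simp add: sg_def)

lemma sum_Pow_sym_diff:
  assumes "E \<subseteq> A"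
  shows "(\<Sum>S\<in>Pow A. f (sym_diff S E)) = (\<Sum>S\<in>Pow A. f S)"
  by (rule sum.reindex_bij_witness[of _ "\<lambda>S. sym_diff S E" "\<lambda>S. sym_diff S E"])
    (use assms in \<open>auto intro!: arg_cong[of _ _ f]\<close>)

text \<open>For each fixed E the flip permutes \<open>Pow {..<N}\<close>, so an average over E can
  be inserted. This is the finite form of conditioning on the signs whose index is not one of the M
  multiples of k.\<close>

lemma average_flip:
  fixes f :: "nat set \<Rightarrow> real"
  assumes "k * M \<le> N" "k \<ge> 1"
  shows "(\<Sum>S\<in>Pow {..<N}. f S) = (\<Sum>S\<in>Pow {..<N}. (\<Sum>E\<in>Pow {..<M}. f (flip k S E)) / 2 ^ M)"
proof -
  have "(\<Sum>S\<in>Pow {..<N}. f (flip k S E)) = (\<Sum>S\<in>Pow {..<N}. f S)" if "E \<in> Pow {..<M}" for E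
    unfolding flip_def using that assms
    by (intro sum_Pow_sym_diff) (auto intro: less_le_trans[OF mult_strict_left_mono])
  then have "(\<Sum>E\<in>Pow {..<M}. \<Sum>S\<in>Pow {..<N}. f (flip k S E)) = 2 ^ M * (\<Sum>S\<in>Pow {..<N}. f S)"
    by (simp add: card_Pow)
  then show ?thesis
    by (subst (asm) sum.swap) (simp add: sum_divide_distrib[symmetric])
qed

context window
begin

section \<open>The energy and the derivative of the sign average\<close>

definition "energy_const = 4 * weight_bound * ((b - a) / a) +
  pair_const * (\<Sum>m. (real m + 1) ^ 4 * (1 / (2 * b1 powr (1 + s))) ^ m)"

lemma energy_const_nonneg: "energy_const \<ge> 0"
  unfolding energy_const_def using weight_bound_nonneg ab pair_const_nonneg b1 s
  by (intro add_nonneg_nonneg mult_nonneg_nonneg suminf_nonneg summable_poly_geometric) auto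

text \<open>Writing E' as the symmetric difference of G and E, the two patterns first differ at k
  times \<open>Min G\<close>. Counting the G by their minimum m turns the off-diagonal pairs into
  the convergent series of (m + 1)^4 q^m with q = 1 / (2 b1^(1 + s)). The empty G is the
  diagonal.\<close>

lemma energy_le:
  assumes \<eta>: "0 < \<eta>" "\<eta> \<le> 1" and N: "k * M \<le> N" and M: "(1/2) ^ M \<le> \<eta> ^ 2"
  shows "(\<Sum>E\<in>Pow {..<M}. \<Sum>E'\<in>Pow {..<M}. pair_integral N \<eta> (sg (flip k S E)) (sg (flip k S E')))
     \<le> 4 ^ M * (energy_const * \<eta> powr (2 + s))"
proof -
  define q where "q = 1 / (2 * b1 powr (1 + s))"
  have q: "0 \<le> q" "q < 1" using s b1 by (auto simp: q_def)
  define L where "L = (\<Sum>m. (real m + 1) ^ 4 * q ^ m)"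
  define g where "g m = pair_const * \<eta> * (real m + 1) ^ 4 * (\<eta> / b1 ^ m) powr (1 + s)" for m :: nat
  have g_nonneg: "g m \<ge> 0" for m unfolding g_def using pair_const_nonneg \<eta> by auto
  have g_eq: "2 ^ (M - m - 1) * g m \<le> 2 ^ M * (pair_const * \<eta> powr (2 + s)) * ((real m + 1) ^ 4 * q ^ m)" if "m < M" for m
  proof -
    have "(2::real) ^ (M - m - 1) \<le> 2 ^ (M - m)" by (intro power_increasing) auto
    also have "\<dots> = 2 ^ M * (1/2) ^ m" using that by (simp add: power_diff power_one_over)
    finally have "2 ^ (M - m - 1) * g m \<le> 2 ^ M * (1/2) ^ m * g m"
      using g_nonneg by (rule mult_right_mono)
    also have "(b1 ^ m) powr (1 + s) = (b1 powr (1 + s)) ^ m"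
      using b1 by (simp add: powr_powr mult.commute flip: powr_realpow)
    then have "(\<eta> / b1 ^ m) powr (1 + s) = \<eta> powr (1 + s) / (b1 powr (1 + s)) ^ m"
      using \<eta> b1 by (simp add: powr_divide)
    then have "2 ^ M * (1/2) ^ m * g m = 2 ^ M * (pair_const * (\<eta> * \<eta> powr (1 + s))) * ((real m + 1) ^ 4 * q ^ m)"
      by (simp add: g_def q_def power_divide power_mult_distrib)
    also have "\<eta> * \<eta> powr (1 + s) = \<eta> powr (2 + s)"
      using \<eta> powr_add[of \<eta> 1 "1 + s"] by (simp add: add.assoc[symmetric])
    finally show ?thesis .
  qed
  have main: "(\<Sum>E'\<in>Pow {..<M}. pair_integral N \<eta> (sg (flip k S E)) (sg (flip k S E')))
      \<le> 2 ^ M * (energy_const * \<eta> powr (2 + s))" if E: "E \<in> Pow {..<M}" for E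
  proof -
    define F where "F E' = pair_integral N \<eta> (sg (flip k S E)) (sg (flip k S E'))" for E'
    have FG: "F (sym_diff G E) \<le> g (Min G)" if G: "G \<in> Pow {..<M} - {{}}" for G
    proof -
      have fin: "finite G" using G finite_subset[of G "{..<M}"] by auto
      have m: "Min G \<in> G" using G fin by (intro Min_in) auto
      have "\<bar>pair_integral N \<eta> (sg (flip k S E)) (sg (flip k S (sym_diff G E)))\<bar> \<le> g (Min G)"
        unfolding g_def
      proof (rule abs_pair_integral_le[OF abs_sg abs_sg \<eta>(1) _ N])
        show "Min G < M" using m G by auto
        show "i \<in> (*) k ` {Min G..<M}" if "sg (flip k S E) i \<noteq> sg (flip k S (sym_diff G E)) i" for i
        proof -
          from that have "i \<in> (*) k ` G" by (auto simp: sg_def flip_def split: if_splits)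
          moreover have "G \<subseteq> {Min G..<M}" using G fin by auto
          ultimately show ?thesis by blast
        qed
        have inj: "k * l \<in> (*) k ` X \<longleftrightarrow> l \<in> X" for l X using k by auto
        show "\<bar>sg (flip k S E) (k * Min G) - sg (flip k S (sym_diff G E)) (k * Min G)\<bar> = 2"
          unfolding sg_def flip_def Un_iff Diff_iff inj using m by auto
      qed
      then show ?thesis unfolding F_def by linarith
    qed
    have "(\<Sum>E'\<in>Pow {..<M}. F E') = (\<Sum>G\<in>Pow {..<M}. F (sym_diff G E))"
      using E by (intro sum_Pow_sym_diff[symmetric]) auto
    also have "\<dots> = F E + (\<Sum>G\<in>Pow {..<M} - {{}}. F (sym_diff G E))"
      by (subst sum.remove[of _ "{}"]) auto
    also have "(\<Sum>G\<in>Pow {..<M} - {{}}. F (sym_diff G E)) \<le> (\<Sum>G\<in>Pow {..<M} - {{}}. g (Min G))"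
      using FG by (rule sum_mono)
    also have "\<dots> \<le> (\<Sum>m<M. 2 ^ (M - m - 1) * g m)"
      by (rule sum_Min_le[OF g_nonneg])
    also have "\<dots> \<le> (\<Sum>m<M. 2 ^ M * (pair_const * \<eta> powr (2 + s)) * ((real m + 1) ^ 4 * q ^ m))"
      using g_eq by (intro sum_mono) auto
    also have "\<dots> = 2 ^ M * (pair_const * \<eta> powr (2 + s)) * (\<Sum>m<M. (real m + 1) ^ 4 * q ^ m)"
      by (simp add: sum_distrib_left)
    also have "\<dots> \<le> 2 ^ M * (pair_const * \<eta> powr (2 + s)) * L"
      unfolding L_def using q pair_const_nonneg
      by (intro mult_left_mono sum_le_suminf summable_poly_geometric) auto
    \<comment> \<open>The diagonal has no oscillation to exploit, but it is a fraction 2^(-M) of all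
      pairs: the choice of M bounds its share by \<eta>^3, hence by the power 2 + s.\<close>
    also have "F E \<le> 2 ^ M * (4 * weight_bound * ((b - a) / a) * \<eta> powr (2 + s))"
    proof -
      have "F E \<le> 4 * \<eta> * weight_bound * ((b - a) / a)"
        unfolding F_def using pair_integral_trivial[OF abs_sg abs_sg \<eta>(1)] by (meson abs_le_D1)
      also have "\<dots> = 2 ^ M * (4 * weight_bound * ((b - a) / a) * (\<eta> * (1/2) ^ M))" by (simp add: power_one_over)
      also have "\<dots> \<le> 2 ^ M * (4 * weight_bound * ((b - a) / a) * \<eta> powr (2 + s))"
      proof (intro mult_left_mono)
        have "\<eta> * (1/2) ^ M \<le> \<eta> powr 3"
          using \<eta> mult_left_mono[OF M, of \<eta>] by (simp add: power2_eq_square power3_eq_cube)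
        also have "\<dots> \<le> \<eta> powr (2 + s)" using \<eta> s by (intro powr_mono') auto
        finally show "\<eta> * (1/2) ^ M \<le> \<eta> powr (2 + s)" .
      qed (use weight_bound_nonneg ab in auto)
      finally show ?thesis .
    qed
    finally show ?thesis unfolding F_def energy_const_def L_def q_def by (simp add: algebra_simps)
  qed
  have "(\<Sum>E\<in>Pow {..<M}. \<Sum>E'\<in>Pow {..<M}. pair_integral N \<eta> (sg (flip k S E)) (sg (flip k S E')))
     \<le> (\<Sum>E\<in>Pow {..<M}. 2 ^ M * (energy_const * \<eta> powr (2 + s)))"
    using main by (rule sum_mono)
  also have "\<dots> = 2 ^ M * 2 ^ M * (energy_const * \<eta> powr (2 + s))" by (simp add: card_Pow)
  also have "\<dots> = 4 ^ M * (energy_const * \<eta> powr (2 + s))" by (simp flip: power_mult_distrib)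
  finally show ?thesis .
qed

text \<open>For fixed x and S, Cauchy-Schwarz is applied to the average over flips, with points X
  and coefficients x X' / 2^M. Multiplication by \<psi>(x) / x and integration turn the quadratic
  form into the energy. The parameter t stays free, to be balanced against \<eta> later.\<close>

lemma weighted_derivative_le:
  assumes e: "\<And>x. (E has_real_derivative e x) (at x)" and e0: "\<And>x. \<bar>e x\<bar> \<le> e0" and "t > 0"
    and \<eta>: "0 < \<eta>" "\<eta> \<le> 1" and N: "k * M \<le> N" and M: "(1/2) ^ M \<le> \<eta> ^ 2"
  defines "G \<equiv> (\<lambda>x. E (x + \<eta>) - 2 * E x + E (x - \<eta>))"
  shows "integral {a..b} (\<lambda>x. \<psi> x * \<bar>(\<Sum>S\<in>Pow {..<N}. G (psum N (sg S) 0 x) * psum N (sg S) 1 x / x) / 2 ^ N\<bar>)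
     \<le> e0 * (energy_const * \<eta> powr (2 + s) / (2 * t) + t * (Z + 1) * (K / a * (b - a)))"
proof -
  define X where "X S r x = psum N (sg S) r x" for S r x
  \<comment> \<open>The quadratic form already carries the weight \<psi>(x) / x, so its integral is
    the normalised double sum of pair integrals.\<close>
  define Q where "Q S x = (\<Sum>A\<in>Pow {..<M}. \<Sum>A'\<in>Pow {..<M}.
      haar_corr \<eta> (X (flip k S A) 0 x - X (flip k S A') 0 x) *
        (\<psi> x * X (flip k S A) 1 x * X (flip k S A') 1 x) / x) / 4 ^ M" for S x
  have e0': "e0 \<ge> 0" using e0[of 0] by linarith
  have pt: "\<psi> x * \<bar>(\<Sum>S\<in>Pow {..<N}. G (X S 0 x) * X S 1 x / x) / 2 ^ N\<bar>
      \<le> (\<Sum>S\<in>Pow {..<N}. e0 * (Q S x / (2 * t) + t * (Z + 1) * (K / a))) / 2 ^ N" if x: "x \<in> {a..b}" for x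
  proof -
    have x0: "x > 0" using x ab by auto
    have 1: "\<bar>(\<Sum>A\<in>Pow {..<M}. G (X (flip k S A) 0 x) * X (flip k S A) 1 x / x) / 2 ^ M\<bar> * \<psi> x
       \<le> e0 * (Q S x / (2 * t) + t * (Z + 1) * (K / a))" for S
    proof -
      let ?c = "\<lambda>A. X (flip k S A) 1 x / 2 ^ M" and ?x = "\<lambda>A. X (flip k S A) 0 x"
      have "\<bar>\<Sum>A\<in>Pow {..<M}. ?c A * (E (?x A + \<eta>) - 2 * E (?x A) + E (?x A - \<eta>))\<bar> \<le>
         e0 * ((\<Sum>A\<in>Pow {..<M}. \<Sum>A'\<in>Pow {..<M}. ?c A * ?c A' * haar_corr \<eta> (?x A - ?x A')) / (2 * t) + t * (Z + 1))"
        unfolding X_def using assms x ab Z_ge_1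
        by (intro abs_sum_second_difference_le[OF e e0]) (auto intro!: abs_psum_le' abs_sg)
      from mult_right_mono[OF this, of "\<psi> x / x"]
      have "\<bar>\<Sum>A\<in>Pow {..<M}. ?c A * G (?x A)\<bar> * (\<psi> x / x) \<le>
         e0 * ((\<Sum>A\<in>Pow {..<M}. \<Sum>A'\<in>Pow {..<M}. ?c A * ?c A' * haar_corr \<eta> (?x A - ?x A')) / (2 * t) + t * (Z + 1)) * (\<psi> x / x)"
        using \<psi>_ge[of x] x0 by (simp add: G_def)
      also have "\<dots> = e0 * (((\<Sum>A\<in>Pow {..<M}. \<Sum>A'\<in>Pow {..<M}. ?c A * ?c A' * haar_corr \<eta> (?x A - ?x A')) * (\<psi> x / x)) / (2 * t) + t * (Z + 1) * (\<psi> x / x))"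
        by (simp add: algebra_simps add_divide_distrib)
      also have "(\<Sum>A\<in>Pow {..<M}. \<Sum>A'\<in>Pow {..<M}. ?c A * ?c A' * haar_corr \<eta> (?x A - ?x A')) * (\<psi> x / x) = Q S x"
      proof -
        have four: "(4::real) ^ M = 2 ^ M * 2 ^ M" by (simp flip: power_mult_distrib)
        show ?thesis unfolding Q_def sum_distrib_right sum_divide_distrib four
          by (intro sum.cong refl) (simp add: field_simps)
      qed
      also have "e0 * (Q S x / (2 * t) + t * (Z + 1) * (\<psi> x / x)) \<le> e0 * (Q S x / (2 * t) + t * (Z + 1) * (K / a))"
        using \<psi>_le[OF x] \<psi>_ge[of x] x ab e0' \<open>t > 0\<close> Z_ge_1
        by (intro mult_left_mono add_left_mono frac_le) auto
      also have "\<bar>\<Sum>A\<in>Pow {..<M}. ?c A * G (?x A)\<bar> * (\<psi> x / x) =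
          \<bar>(\<Sum>A\<in>Pow {..<M}. G (?x A) * X (flip k S A) 1 x / x) / 2 ^ M\<bar> * \<psi> x"
      proof -
        have "(\<Sum>A\<in>Pow {..<M}. G (?x A) * X (flip k S A) 1 x / x) / 2 ^ M = (\<Sum>A\<in>Pow {..<M}. ?c A * G (?x A)) / x"
          unfolding sum_divide_distrib by (intro sum.cong refl) (simp add: field_simps)
        then show ?thesis using x0 by (simp add: abs_divide)
      qed
      finally show ?thesis .
    qed
    have "\<psi> x * \<bar>(\<Sum>S\<in>Pow {..<N}. G (X S 0 x) * X S 1 x / x) / 2 ^ N\<bar> =
       \<bar>\<Sum>S\<in>Pow {..<N}. (\<Sum>A\<in>Pow {..<M}. G (X (flip k S A) 0 x) * X (flip k S A) 1 x / x) / 2 ^ M\<bar> * \<psi> x / 2 ^ N"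
      by (subst average_flip[OF N k]) simp
    also have "\<dots> \<le> (\<Sum>S\<in>Pow {..<N}. \<bar>(\<Sum>A\<in>Pow {..<M}. G (X (flip k S A) 0 x) * X (flip k S A) 1 x / x) / 2 ^ M\<bar>) * \<psi> x / 2 ^ N"
      using \<psi>_ge[of x] by (intro divide_right_mono mult_right_mono sum_abs) auto
    also have "\<dots> \<le> (\<Sum>S\<in>Pow {..<N}. e0 * (Q S x / (2 * t) + t * (Z + 1) * (K / a))) / 2 ^ N"
      unfolding sum_distrib_right by (intro divide_right_mono sum_mono 1) auto
    finally show ?thesis .
  qed
  have Qint: "(Q S has_integral (\<Sum>A\<in>Pow {..<M}. \<Sum>A'\<in>Pow {..<M}.
      pair_integral N \<eta> (sg (flip k S A)) (sg (flip k S A'))) / 4 ^ M) {a..b}" (is "(_ has_integral ?J S) _") for S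
  proof -
    have "((\<lambda>x. haar_corr \<eta> (X A 0 x - X A' 0 x) * (\<psi> x * X A 1 x * X A' 1 x) / x) has_integral
      pair_integral N \<eta> (sg A) (sg A')) {a..b}" for A A'
      unfolding pair_integral_def X_def using ab
      by (intro integrable_integral) (unfold haar_corr_def tent_def,
        intro integrable_continuous_real continuous_intros continuous_on_psum continuous_on_\<psi>, auto)
    then show ?thesis unfolding Q_def[abs_def]
      by (intro has_integral_divide has_integral_sum) auto
  qed
  have R: "((\<lambda>x. (\<Sum>S\<in>Pow {..<N}. e0 * (Q S x / (2 * t) + t * (Z + 1) * (K / a))) / 2 ^ N) has_integral
     (\<Sum>S\<in>Pow {..<N}. e0 * (?J S / (2 * t) + (b - a) * (t * (Z + 1) * (K / a)))) / 2 ^ N) {a..b}"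
    using has_integral_const_real[of "t * (Z + 1) * (K / a)" a b] ab
    by (intro has_integral_divide has_integral_sum has_integral_mult_right has_integral_add Qint) auto
  have cE: "continuous_on UNIV E"
    using e by (auto intro!: continuous_at_imp_continuous_on DERIV_isCont)
  have cG: "continuous_on UNIV G"
    unfolding G_def by (intro continuous_intros continuous_on_compose2[OF cE]) auto
  have "(\<lambda>x. \<psi> x * \<bar>(\<Sum>S\<in>Pow {..<N}. G (X S 0 x) * X S 1 x / x) / 2 ^ N\<bar>) integrable_on {a..b}"
    unfolding X_def using ab
    by (intro integrable_continuous_real continuous_intros continuous_on_psum continuous_on_\<psi>
        continuous_on_compose2[OF cG]) auto
  then have "integral {a..b} (\<lambda>x. \<psi> x * \<bar>(\<Sum>S\<in>Pow {..<N}. G (X S 0 x) * X S 1 x / x) / 2 ^ N\<bar>)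
     \<le> (\<Sum>S\<in>Pow {..<N}. e0 * (?J S / (2 * t) + (b - a) * (t * (Z + 1) * (K / a)))) / 2 ^ N"
    using R pt by (intro has_integral_le[OF integrable_integral R]) auto
  also have "\<dots> \<le> (\<Sum>S\<in>Pow {..<N}. e0 * (energy_const * \<eta> powr (2 + s) / (2 * t) + (b - a) * (t * (Z + 1) * (K / a)))) / 2 ^ N"
    using energy_le[OF \<eta> N M] e0' \<open>t > 0\<close>
    by (intro divide_right_mono sum_mono mult_left_mono add_right_mono) (auto simp: divide_le_eq mult_ac)
  also have "\<dots> = e0 * (energy_const * \<eta> powr (2 + s) / (2 * t) + t * (Z + 1) * (K / a * (b - a)))"
    by (simp add: card_Pow)
  finally show ?thesis unfolding X_def .
qed

end

section \<open>Mollification\<close>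

text \<open>Convolution with the tent function of half-width \<open>\<eta>\<close>, expressed through a second antiderivative.\<close>

definition second_quotient :: "(real \<Rightarrow> real) \<Rightarrow> real \<Rightarrow> real \<Rightarrow> real" where
  "second_quotient F \<eta> x = (F (x + \<eta>) - 2 * F x + F (x - \<eta>)) / \<eta>\<^sup>2"

text \<open>Refinement equation of the tent: the wide tent is the (1, 2, 1) / 4 average of narrow
  ones. Hence the difference of consecutive mollifications is itself a second difference.\<close>

lemma second_quotient_double:
  "second_quotient F (2 * \<eta>) x =
     (second_quotient F \<eta> (x + \<eta>) + 2 * second_quotient F \<eta> x + second_quotient F \<eta> (x - \<eta>)) / 4"
proof (cases "\<eta> = 0")
  case False
  then show ?thesis by (simp add: second_quotient_def field_simps power2_eq_square)
qed (simp add: second_quotient_def)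

lemma has_real_derivative_second_quotient:
  assumes "\<And>x. (F has_real_derivative f x) (at x)"
  shows "(second_quotient F \<eta> has_real_derivative second_quotient f \<eta> x) (at x)"
proof -
  have *: "((\<lambda>x. F (x + c)) has_real_derivative f (x + c)) (at x)" for c x
    using assms[of "x + c"] by (simp add: DERIV_shift)
  show ?thesis
    unfolding second_quotient_def[abs_def]
    using *[of \<eta> x] *[of "- \<eta>" x] assms[of x]
    by (intro DERIV_cdivide DERIV_add DERIV_diff DERIV_cmult) auto
qed

lemma continuous_on_second_quotient:
  assumes "\<And>x. (F has_real_derivative f x) (at x)"
  shows "continuous_on A (second_quotient F \<eta>)"
  using has_real_derivative_second_quotient[of F f, OF assms]
  by (auto intro!: continuous_at_imp_continuous_on DERIV_isCont)

lemma antiderivative_exists: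
  fixes f :: "real \<Rightarrow> real"
  assumes "\<And>x. isCont f x"
  obtains F where "\<And>x. (F has_real_derivative f x) (at x)"
  using einterval_antiderivative[of "-\<infinity>" "\<infinity>" f] assms
  by (auto simp: has_real_derivative_iff_has_vector_derivative)

lemma second_quotient_approx:
  assumes F: "\<And>x. (F has_real_derivative f x) (at x)" and f: "\<And>x. (f has_real_derivative g x) (at x)"
    and g: "\<And>x y. \<bar>g x - g y\<bar> \<le> C * \<bar>x - y\<bar> powr \<alpha>" and "0 < \<alpha>" "0 < \<eta>" "C \<ge> 0"
  shows "\<bar>second_quotient F \<eta> x - g x\<bar> \<le> 2 * C * \<eta> powr \<alpha>"
proof -
  \<comment> \<open>A Taylor remainder with r 0 = r1 0 = 0, r' = r1, and the second difference of g
    as derivative of r1. Two applications of the mean value theorem reach that difference at some w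
    below \<eta>.\<close>
  define r where "r t = F (x + t) - 2 * F x + F (x - t) - g x * t\<^sup>2" for t
  define r1 where "r1 t = f (x + t) - f (x - t) - 2 * g x * t" for t
  have sh: "((\<lambda>t. h (x + t)) has_real_derivative h' (x + t)) (at t)"
    "((\<lambda>t. h (x - t)) has_real_derivative - h' (x - t)) (at t)"
    if "\<And>y. (h has_real_derivative h' y) (at y)" for h h' :: "real \<Rightarrow> real" and t
  proof -
    have l: "((\<lambda>t. x + t) has_real_derivative 1) (at t)" "((\<lambda>t. x - t) has_real_derivative -1) (at t)"
      by (auto intro!: derivative_eq_intros)
    show "((\<lambda>t. h (x + t)) has_real_derivative h' (x + t)) (at t)"
      "((\<lambda>t. h (x - t)) has_real_derivative - h' (x - t)) (at t)"
      using DERIV_chain2[OF that l(1)] DERIV_chain2[OF that l(2)] by simp_all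
  qed
  have d: "(r has_real_derivative r1 t) (at t)" for t
    unfolding r_def[abs_def] r1_def using sh[of F f, OF F] by (auto intro!: derivative_eq_intros)
  have d1: "(r1 has_real_derivative g (x + t) + g (x - t) - 2 * g x) (at t)" for t
    unfolding r1_def[abs_def] using sh[of f g, OF f] by (auto intro!: derivative_eq_intros)
  obtain z where z: "0 < z" "z < \<eta>" "r \<eta> - r 0 = (\<eta> - 0) * r1 z"
    using MVT2[of 0 \<eta> r r1] \<open>0 < \<eta>\<close> d by blast
  obtain w where w: "0 < w" "w < z" "r1 z - r1 0 = (z - 0) * (g (x + w) + g (x - w) - 2 * g x)"
    using MVT2[of 0 z r1 "\<lambda>t. g (x + t) + g (x - t) - 2 * g x"] z(1) d1 by blast
  have "w powr \<alpha> \<le> \<eta> powr \<alpha>" using z w assms by (intro powr_mono2) auto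
  then have "C * w powr \<alpha> \<le> C * \<eta> powr \<alpha>" using assms by (intro mult_left_mono) auto
  then have b: "\<bar>g (x + w) + g (x - w) - 2 * g x\<bar> \<le> 2 * C * \<eta> powr \<alpha>"
    using g[of "x + w" x] g[of "x - w" x] w by simp
  have "\<bar>r \<eta>\<bar> = \<eta> * (z * \<bar>g (x + w) + g (x - w) - 2 * g x\<bar>)"
    using z w by (simp add: r_def r1_def abs_mult)
  also have "\<dots> \<le> \<eta> * (\<eta> * (2 * C * \<eta> powr \<alpha>))"
    using z b assms by (intro mult_mono) auto
  finally have "\<bar>r \<eta>\<bar> \<le> \<eta>\<^sup>2 * (2 * C * \<eta> powr \<alpha>)" by (simp add: power2_eq_square)
  moreover have "second_quotient F \<eta> x - g x = r \<eta> / \<eta>\<^sup>2"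
    using \<open>0 < \<eta>\<close> by (simp add: second_quotient_def r_def field_simps)
  ultimately show ?thesis using \<open>0 < \<eta>\<close> by (simp add: divide_le_eq mult_ac)
qed

section \<open>Averages over finitely many signs\<close>

definition sign_average :: "nat \<Rightarrow> (real \<Rightarrow> real) \<Rightarrow> real \<Rightarrow> real" where
  "sign_average N F x = (\<Sum>S\<in>Pow {..<N}. F (psum N (sg S) 0 x)) / 2 ^ N"

definition sign_average_deriv :: "nat \<Rightarrow> (real \<Rightarrow> real) \<Rightarrow> real \<Rightarrow> real" where
  "sign_average_deriv N f x = (\<Sum>S\<in>Pow {..<N}. f (psum N (sg S) 0 x) * psum N (sg S) 1 x / x) / 2 ^ N"

lemma has_real_derivative_sign_average:
  assumes "\<And>y. (F has_real_derivative f y) (at y)" "x > 0"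
  shows "(sign_average N F has_real_derivative sign_average_deriv N f x) (at x)"
proof -
  have "((\<lambda>x. F (psum N (sg S) 0 x)) has_real_derivative f (psum N (sg S) 0 x) * psum N (sg S) 1 x / x) (at x)" for S
    using DERIV_chain2[OF assms(1) has_real_derivative_psum[OF assms(2), of N "sg S" 0]] by simp
  then show ?thesis
    unfolding sign_average_def[abs_def] sign_average_deriv_def
    by (intro DERIV_cdivide DERIV_sum)
qed

lemma continuous_on_sign_average_deriv:
  assumes "continuous_on UNIV f" "A \<subseteq> {0<..}"
  shows "continuous_on A (sign_average_deriv N f)"
  unfolding sign_average_deriv_def[abs_def] psum_def[abs_def] using assms(2)
  by (intro continuous_intros continuous_on_compose2[OF assms(1)]) auto

text \<open>By the refinement equation the integrand involves G / \<eta>^2, with G the second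
  difference of an E whose derivative has size C \<eta>^\<alpha>. Together with the bound t from the
  energy this gives \<eta>^(\<alpha> + 1 + s/2 - 2), at most \<eta>^(s/4) since \<alpha> >= 1 - s/4.
  Dividing by \<kappa> removes the cutoff on the inner interval.\<close>

lemma (in window) integral_sign_average_deriv_le:
  assumes F1: "\<And>x. (F1 has_real_derivative \<phi> x) (at x)"
    and \<phi>: "\<And>x y. \<bar>\<phi> x - \<phi> y\<bar> \<le> C * \<bar>x - y\<bar> powr \<alpha>" and "C \<ge> 0" "1 - s / 4 \<le> \<alpha>"
    and N: "k * (2 * j + 2) \<le> N" and \<eta>: "\<eta> = (1/2) ^ (j + 1)"
    and a'b': "{a'..b'} \<subseteq> {a..b}" and \<kappa>: "\<kappa> > 0" "\<And>x. x \<in> {a'..b'} \<Longrightarrow> \<kappa> \<le> \<psi> x"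
  shows "integral {a'..b'} (\<lambda>x. \<bar>sign_average_deriv N (\<lambda>y. second_quotient F1 \<eta> y - second_quotient F1 (2 * \<eta>) y) x\<bar>)
     \<le> C * ((energy_const + (Z + 1) * (K / a * (b - a))) / \<kappa>) * \<eta> powr (s / 4)"
proof -
  define E where "E x = F1 x / 2 - F1 (x + \<eta>) / 4 - F1 (x - \<eta>) / 4" for x
  define e where "e x = \<phi> x / 2 - \<phi> (x + \<eta>) / 4 - \<phi> (x - \<eta>) / 4" for x
  define e0 where "e0 = C * \<eta> powr \<alpha>"
  define G where "G x = E (x + \<eta>) - 2 * E x + E (x - \<eta>)" for x
  define D where "D x = sign_average_deriv N (\<lambda>y. second_quotient F1 \<eta> y - second_quotient F1 (2 * \<eta>) y) x" for x
  \<comment> \<open>This choice balances the two Cauchy-Schwarz terms, as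
    \<open>\<eta> powr (2 + s)\<close> equals t * t.\<close>
  define t where "t = \<eta> powr (1 + s / 2)"
  have \<eta>01: "0 < \<eta>" "\<eta> \<le> 1" unfolding \<eta> by (simp, rule power_le_one, auto)
  have t: "t > 0" using \<eta>01 by (simp add: t_def)
  have *: "((\<lambda>x. F1 (x + c)) has_real_derivative \<phi> (x + c)) (at x)" for c x
    using F1[of "x + c"] by (simp add: DERIV_shift)
  have dE: "(E has_real_derivative e x) (at x)" for x
    unfolding E_def[abs_def] e_def using *[of \<eta> x] *[of "- \<eta>" x] F1[of x]
    by (auto intro!: derivative_eq_intros)
  have e0: "\<bar>e x\<bar> \<le> e0" for x
  proof -
    have "e x = (\<phi> x - \<phi> (x + \<eta>)) / 4 + (\<phi> x - \<phi> (x - \<eta>)) / 4" by (simp add: e_def field_simps)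
    moreover have "\<bar>\<phi> x - \<phi> (x + \<eta>)\<bar> \<le> e0" "\<bar>\<phi> x - \<phi> (x - \<eta>)\<bar> \<le> e0"
      using \<phi>[of x "x + \<eta>"] \<phi>[of x "x - \<eta>"] \<eta>01 by (simp_all add: e0_def)
    moreover have "e0 \<ge> 0" using \<open>C \<ge> 0\<close> by (simp add: e0_def)
    moreover have "\<bar>u\<bar> \<le> e0 \<Longrightarrow> \<bar>v\<bar> \<le> e0 \<Longrightarrow> 0 \<le> e0 \<Longrightarrow> \<bar>u / 4 + v / 4\<bar> \<le> e0" for u v :: real
      by linarith
    ultimately show ?thesis by metis
  qed
  \<comment> \<open>Taking M = 2 j + 2 gives equality; this is why k (2 j + 2) signs must be
    available.\<close>
  have M: "(1/2) ^ (2 * j + 2) \<le> \<eta> ^ 2" unfolding \<eta> power_mult[symmetric] by (simp add: algebra_simps)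
  have sq: "second_quotient F1 \<eta> y - second_quotient F1 (2 * \<eta>) y = G y / \<eta>\<^sup>2" for y
    unfolding second_quotient_double G_def E_def using \<eta>01
    by (simp add: second_quotient_def field_simps)
  have D: "D x = (\<Sum>S\<in>Pow {..<N}. G (psum N (sg S) 0 x) * psum N (sg S) 1 x / x) / 2 ^ N / \<eta>\<^sup>2" for x
    unfolding D_def sign_average_deriv_def sq by (simp add: sum_divide_distrib field_simps)
  have cD: "continuous_on {a..b} D"
    unfolding D_def[abs_def] using ab
    by (intro continuous_on_sign_average_deriv continuous_intros continuous_on_second_quotient[OF F1]) auto
  have i1: "(\<lambda>x. \<bar>D x\<bar>) integrable_on {a'..b'}"
    by (intro integrable_continuous_real continuous_intros continuous_on_subset[OF cD a'b'])
  have i2: "(\<lambda>x. \<psi> x * \<bar>D x\<bar>) integrable_on {a..b}"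
    by (intro integrable_continuous_real continuous_intros cD continuous_on_\<psi>)
  have "\<kappa> * integral {a'..b'} (\<lambda>x. \<bar>D x\<bar>) = integral {a'..b'} (\<lambda>x. \<kappa> * \<bar>D x\<bar>)" by simp
  also have "\<dots> \<le> integral {a'..b'} (\<lambda>x. \<psi> x * \<bar>D x\<bar>)"
    using i1 \<kappa> by (intro integral_le integrable_subinterval_real[OF i2 a'b']) (auto intro!: mult_right_mono)
  also have "\<dots> \<le> integral {a..b} (\<lambda>x. \<psi> x * \<bar>D x\<bar>)"
    using a'b' i2 \<psi>_ge by (intro integral_subset_le integrable_subinterval_real[OF i2 a'b']) auto
  also have "\<dots> = integral {a..b} (\<lambda>x. \<psi> x * \<bar>(\<Sum>S\<in>Pow {..<N}. G (psum N (sg S) 0 x) * psum N (sg S) 1 x / x) / 2 ^ N\<bar>) / \<eta>\<^sup>2"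
    unfolding D by (simp add: abs_divide)
  also have "\<dots> \<le> (e0 * (energy_const * \<eta> powr (2 + s) / (2 * t) + t * (Z + 1) * (K / a * (b - a)))) / \<eta>\<^sup>2"
    unfolding G_def
    by (intro divide_right_mono weighted_derivative_le[OF dE e0 t \<eta>01 N M]) simp
  also have "\<dots> = (energy_const / 2 + (Z + 1) * (K / a * (b - a))) * (e0 * t / \<eta>\<^sup>2)"
  proof -
    have "\<eta> powr (2 + s) = t * t"
      unfolding t_def by (simp flip: powr_add)
    then have "energy_const * \<eta> powr (2 + s) / (2 * t) = energy_const / 2 * t" using t by simp
    moreover have "(e0 * (u * t + t * v * w)) / \<eta>\<^sup>2 = (u + v * w) * (e0 * t / \<eta>\<^sup>2)" for u v w :: real
      by (simp add: algebra_simps)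
    ultimately show ?thesis by (simp only:)
  qed
  also have "\<dots> \<le> (energy_const + (Z + 1) * (K / a * (b - a))) * (C * \<eta> powr (s / 4))"
  proof (intro mult_mono)
    have "e0 * t / \<eta>\<^sup>2 = C * (\<eta> powr \<alpha> * \<eta> powr (1 + s / 2) / \<eta> powr 2)"
      using \<eta>01 by (simp add: e0_def t_def)
    also have "\<dots> = C * \<eta> powr (\<alpha> + (1 + s / 2) - 2)" by (simp only: powr_add powr_diff)
    also have "\<dots> \<le> C * \<eta> powr (s / 4)"
      using \<open>C \<ge> 0\<close> \<eta>01 \<open>1 - s / 4 \<le> \<alpha>\<close> by (intro mult_left_mono powr_mono') auto
    finally show "e0 * t / \<eta>\<^sup>2 \<le> C * \<eta> powr (s / 4)" .
    show "0 \<le> e0 * t / \<eta>\<^sup>2" using \<open>C \<ge> 0\<close> t by (simp add: e0_def)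
  qed (use energy_const_nonneg Z_ge_1 K_nonneg ab in auto)
  finally show ?thesis using \<kappa> unfolding D_def by (simp add: field_simps)
qed

text \<open>All functions, scales and truncations are quantified inside, so that one constant W
  serves them all; as a predicate it allows a W to be chosen for each k.\<close>

definition window_bound :: "real \<Rightarrow> real \<Rightarrow> nat \<Rightarrow> real \<Rightarrow> bool" where
  "window_bound s b0 k W \<longleftrightarrow> W \<ge> 0 \<and>
     (\<forall>F1 \<phi> C \<alpha> j N. (\<forall>x. (F1 has_real_derivative \<phi> x) (at x)) \<longrightarrow>
     (\<forall>x y. \<bar>\<phi> x - \<phi> y\<bar> \<le> C * \<bar>x - y\<bar> powr \<alpha>) \<longrightarrow> C \<ge> 0 \<longrightarrow> 1 - s / 4 \<le> \<alpha> \<longrightarrow> k * (2 * j + 2) \<le> N \<longrightarrow>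
     integral {root k b0..root k (6/10)} (\<lambda>x. \<bar>sign_average_deriv N
        (\<lambda>y. second_quotient F1 ((1/2) ^ (j + 1)) y - second_quotient F1 (2 * (1/2) ^ (j + 1)) y) x\<bar>)
     \<le> C * W * ((1/2) ^ (j + 1)) powr (s / 4))"

lemma window_boundD:
  assumes "window_bound s b0 k W" "\<And>x. (F1 has_real_derivative \<phi> x) (at x)"
    "\<And>x y. \<bar>\<phi> x - \<phi> y\<bar> \<le> C * \<bar>x - y\<bar> powr \<alpha>" "C \<ge> 0" "1 - s / 4 \<le> \<alpha>" "k * (2 * j + 2) \<le> N"
  shows "integral {root k b0..root k (6/10)} (\<lambda>x. \<bar>sign_average_deriv N
        (\<lambda>y. second_quotient F1 ((1/2) ^ (j + 1)) y - second_quotient F1 (2 * (1/2) ^ (j + 1)) y) x\<bar>)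
     \<le> C * W * ((1/2) ^ (j + 1)) powr (s / 4)"
  using assms unfolding window_bound_def by blast

text \<open>The range b0 to 6/10 of x^k is enlarged to b1 to 61/100, with b1 midway between 1/2 and
  b0. This leaves room for the cutoff while b1 still exceeds 1/2.\<close>

lemma window_bound_exists:
  fixes b0 s :: real and k :: nat
  assumes k: "k \<ge> 1" and b0: "1/2 < b0" "b0 \<le> 6/10" and s: "0 < s" "s \<le> 1" "2 * ((1/2 + b0) / 2) powr (1 + s) > 1"
  shows "\<exists>W. window_bound s b0 k W"
proof -
  define b1 where "b1 = (1/2 + b0) / 2"
  have b1: "0 < b1" "b1 < b0" "b1 \<le> 1" using b0 by (auto simp: b1_def)
  have r: "0 < root k b1" "root k b1 < root k b0" "root k b0 \<le> root k (6/10)" "root k (6/10) < root k (61/100)"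
    using k b0 b1 by auto
  obtain \<psi> \<psi>1 \<psi>2 K \<kappa> where cut: "\<kappa> > 0" "\<And>x. x > 0 \<Longrightarrow> (\<psi> has_real_derivative \<psi>1 x / x) (at x)"
    "\<And>x. x > 0 \<Longrightarrow> (\<psi>1 has_real_derivative \<psi>2 x / x) (at x)"
    "\<psi> (root k b1) = 0" "\<psi> (root k (61/100)) = 0" "\<psi>1 (root k b1) = 0" "\<psi>1 (root k (61/100)) = 0"
    "\<And>x. \<psi> x \<ge> 0" "\<And>x. x \<in> {root k b1..root k (61/100)} \<Longrightarrow> \<bar>\<psi> x\<bar> \<le> K \<and> \<bar>\<psi>1 x\<bar> \<le> K \<and> \<bar>\<psi>2 x\<bar> \<le> K"
    "\<And>x. x \<in> {root k b0..root k (6/10)} \<Longrightarrow> \<kappa> \<le> \<psi> x"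
    by (rule cutoff_exists[OF r]) (rule that)
  interpret window k "root k b1" "root k (61/100)" b1 s K \<psi> \<psi>1 \<psi>2
  proof
    show "b1 \<le> x ^ k" if "root k b1 \<le> x" for x
      using power_mono[OF that, of k] r k b1 by simp
    show "x ^ k \<le> 61/100" if "0 \<le> x" "x \<le> root k (61/100)" for x
      using power_mono[OF that(2,1), of k] k by simp
    show "2 * b1 powr (1 + s) > 1" using s by (simp add: b1_def)
  qed (use k r b1 s cut in auto)
  have sub: "{root k b0..root k (6/10)} \<subseteq> {root k b1..root k (61/100)}" using r by auto
  have "0 \<le> (energy_const + (Z + 1) * (K / root k b1 * (root k (61/100) - root k b1))) / \<kappa>"
    using energy_const_nonneg Z_ge_1 K_nonneg ab cut(1) by (intro divide_nonneg_pos add_nonneg_nonneg mult_nonneg_nonneg) auto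
  then show ?thesis
    unfolding window_bound_def using integral_sign_average_deriv_le[OF _ _ _ _ _ refl sub cut(1,10)] by blast
qed

section \<open>Passage to the limit\<close>

text \<open>Increments are bounded by integrals of |H'|, and the sums of restricted integrands are
  compared pointwise: disjointness allows at most one term |H' x| on the left, the cover supplies at
  least one on the right.\<close>

lemma sum_increments_le:
  fixes H H' :: "real \<Rightarrow> real" and l r :: "'k \<Rightarrow> real"
  assumes H: "\<And>x. x > 0 \<Longrightarrow> (H has_real_derivative H' x) (at x)" and cont: "continuous_on {0<..} H'"
    and "0 < c" and P: "finite P" "\<forall>(u, v)\<in>P. u < v \<and> {u..v} \<subseteq> I"
      "disjoint_family_on (\<lambda>(u, v). {u<..<v}) P"
    and Ks: "finite Ks" "I \<subseteq> (\<Union>k\<in>Ks. {l k..r k})" "I \<subseteq> {c..d}" "\<And>k. k \<in> Ks \<Longrightarrow> {l k..r k} \<subseteq> {c..d}"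
  shows "(\<Sum>(u, v)\<in>P. \<bar>H v - H u\<bar>) \<le> (\<Sum>k\<in>Ks. integral {l k..r k} (\<lambda>x. \<bar>H' x\<bar>))"
proof -
  have int: "(\<lambda>x. \<bar>H' x\<bar>) integrable_on {u..v}" if "{u..v} \<subseteq> {c..d}" for u v
    using that \<open>0 < c\<close>
    by (intro integrable_continuous_real continuous_intros continuous_on_subset[OF cont]) force
  have inc: "\<bar>H v - H u\<bar> \<le> integral {u..v} (\<lambda>x. \<bar>H' x\<bar>)" if "u < v" "{u..v} \<subseteq> {c..d}" for u v
  proof -
    have "x > 0" if "x \<in> {u..v}" for x using that \<open>{u..v} \<subseteq> {c..d}\<close> \<open>0 < c\<close> by force
    then have ftc: "(H' has_integral H v - H u) {u..v}"
      using \<open>u < v\<close> by (intro fundamental_theorem_of_calculus)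
        (auto simp flip: has_real_derivative_iff_has_vector_derivative intro!: H[THEN has_field_derivative_at_within])
    have "norm (integral {u..v} H') \<le> integral {u..v} (\<lambda>x. \<bar>H' x\<bar>)"
      using ftc int[OF that(2)] by (intro integral_norm_bound_integral) auto
    then show ?thesis using integral_unique[OF ftc] by simp
  qed
  have Pc: "fst p < snd p" "{fst p..snd p} \<subseteq> {c..d}" "{fst p..snd p} \<subseteq> I" if "p \<in> P" for p
  proof -
    show "fst p < snd p" and sub: "{fst p..snd p} \<subseteq> I" using P(2) that by (auto simp: case_prod_beta)
    show "{fst p..snd p} \<subseteq> {c..d}" using sub Ks(3) by (rule order_trans)
  qed
  \<comment> \<open>Open boxes, because the closed intervals of P may share endpoints.\<close>
  have 1: "((\<lambda>x. \<Sum>p\<in>P. if x \<in> box (fst p) (snd p) then \<bar>H' x\<bar> else 0) has_integral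
      (\<Sum>p\<in>P. integral {fst p..snd p} (\<lambda>x. \<bar>H' x\<bar>))) {c..d}"
  proof (intro has_integral_sum P(1))
    fix p assume "p \<in> P"
    note sub = Pc(2)[OF this]
    show "((\<lambda>x. if x \<in> box (fst p) (snd p) then \<bar>H' x\<bar> else 0) has_integral
        integral {fst p..snd p} (\<lambda>x. \<bar>H' x\<bar>)) {c..d}"
      using has_integral_restrict_open_subinterval[of "\<lambda>x. \<bar>H' x\<bar>" _ "fst p" "snd p" c d]
        int[OF sub] sub by (simp add: integrable_integral)
  qed
  have 2: "((\<lambda>x. \<Sum>k\<in>Ks. if x \<in> {l k..r k} then \<bar>H' x\<bar> else 0) has_integral
      (\<Sum>k\<in>Ks. integral {l k..r k} (\<lambda>x. \<bar>H' x\<bar>))) {c..d}"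
    by (intro has_integral_sum Ks(1) iffD2[OF has_integral_restrict] integrable_integral int Ks(4))
  have "(\<Sum>(u, v)\<in>P. \<bar>H v - H u\<bar>) \<le> (\<Sum>p\<in>P. integral {fst p..snd p} (\<lambda>x. \<bar>H' x\<bar>))"
  proof (intro sum_mono)
    fix p assume "p \<in> P"
    from inc[OF Pc(1,2)[OF this]]
    show "(case p of (u, v) \<Rightarrow> \<bar>H v - H u\<bar>) \<le> integral {fst p..snd p} (\<lambda>x. \<bar>H' x\<bar>)"
      by (simp add: case_prod_beta)
  qed
  also have "\<dots> \<le> (\<Sum>k\<in>Ks. integral {l k..r k} (\<lambda>x. \<bar>H' x\<bar>))"
  proof (rule has_integral_le[OF 1 2])
    fix x assume "x \<in> {c..d}"
    show "(\<Sum>p\<in>P. if x \<in> box (fst p) (snd p) then \<bar>H' x\<bar> else 0) \<le> (\<Sum>k\<in>Ks. if x \<in> {l k..r k} then \<bar>H' x\<bar> else 0)"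
    proof (cases "\<exists>p\<in>P. x \<in> box (fst p) (snd p)")
      case False
      then have "(\<Sum>p\<in>P. if x \<in> box (fst p) (snd p) then \<bar>H' x\<bar> else 0) = 0" by (intro sum.neutral) auto
      then show ?thesis by (simp add: sum_nonneg)
    next
      case True
      then obtain p where p: "p \<in> P" "x \<in> box (fst p) (snd p)" by blast
      have uniq: "q = p" if "q \<in> P" "x \<in> box (fst q) (snd q)" for q
      proof (rule ccontr)
        assume "q \<noteq> p"
        from disjoint_family_onD[OF P(3) that(1) p(1) this] that(2) p(2)
        show False by (auto simp: case_prod_beta)
      qed
      have "x \<in> box (fst q) (snd q) \<longleftrightarrow> q = p" if "q \<in> P" for q using uniq p that by blast
      then have "(\<Sum>p\<in>P. if x \<in> box (fst p) (snd p) then \<bar>H' x\<bar> else 0) = (\<Sum>q\<in>P. if q = p then \<bar>H' x\<bar> else 0)"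
        by (intro sum.cong refl) (simp only:)
      also have "\<dots> = \<bar>H' x\<bar>" using p P(1) by simp
      also have "x \<in> {fst p..snd p}" using p by auto
      then have "x \<in> I" using Pc(3)[OF p(1)] by blast
      then obtain k where k: "k \<in> Ks" "x \<in> {l k..r k}" using Ks(2) by auto
      have "\<bar>H' x\<bar> \<le> (\<Sum>k\<in>Ks. if x \<in> {l k..r k} then \<bar>H' x\<bar> else 0)"
        using member_le_sum[of k Ks "\<lambda>k. if x \<in> {l k..r k} then \<bar>H' x\<bar> else 0"] k Ks(1) by auto
      finally show ?thesis .
    qed
  qed
  finally show ?thesis .
qed

text \<open>If x^3 <= 6/10, then k = 3 works, since x^3 exceeds 1/2 + \<epsilon>^3. Otherwise the
  least k with x^k <= 6/10 works: x is close enough to 1 for x^k not to drop far below 6/10.\<close>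

lemma window_cover:
  fixes \<epsilon> x :: real
  assumes "\<epsilon> > 0" and x: "2 powr (- 1 / 3) + \<epsilon> < x" "x < 1 - \<epsilon>" and K: "(1 - \<epsilon>) ^ K \<le> 6/10" "3 \<le> K"
  shows "\<exists>k\<in>{3..K}. root k (min (1/2 + \<epsilon> ^ 3) (504/1000)) \<le> x \<and> x \<le> root k (6/10)"
proof -
  define b0 where "b0 = min (1/2 + \<epsilon> ^ 3) (504/1000)"
  have p0: "(0::real) < 2 powr (- 1 / 3)" by simp
  have x0: "0 < x" "x < 1" using x p0 assms by linarith+
  have xK: "x ^ K \<le> 6/10" using power_mono[of x "1 - \<epsilon>" K] x x0 K by linarith
  have *: "\<exists>k\<in>{3..K}. b0 \<le> x ^ k \<and> x ^ k \<le> 6/10"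
  proof (cases "x ^ 3 \<le> 6/10")
    case True
    have "((2::real) powr (- 1 / 3)) ^ 3 = 1/2"
    proof -
      have "((2::real) powr (- 1 / 3)) ^ 3 = (2 powr (- 1 / 3)) powr 3" by simp
      also have "\<dots> = 2 powr (- 1)" unfolding powr_powr by simp
      finally show ?thesis by (simp add: powr_minus_divide)
    qed
    then have "1/2 + \<epsilon> ^ 3 \<le> (2 powr (- 1 / 3) + \<epsilon>) ^ 3"
      using p0 \<open>\<epsilon> > 0\<close> by (simp add: power3_eq_cube algebra_simps)
    also have "\<dots> \<le> x ^ 3" using x p0 \<open>\<epsilon> > 0\<close> by (intro power_mono) auto
    finally show ?thesis using True K by (intro bexI[of _ 3]) (auto simp: b0_def)
  next
    case False
    define k where "k = (LEAST k. x ^ k \<le> 6/10)"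
    have k: "x ^ k \<le> 6/10" unfolding k_def using xK by (rule LeastI)
    have kK: "k \<le> K" unfolding k_def using xK by (rule Least_le)
    have k3: "k > 3"
    proof (rule ccontr)
      assume "\<not> k > 3"
      then have "x ^ 3 \<le> x ^ k" using x0 by (intro power_decreasing) auto
      then show False using k False by linarith
    qed
    have "\<not> x ^ (k - 1) \<le> 6/10" using k3 not_less_Least[of "k - 1" "\<lambda>k. x ^ k \<le> 6/10"] by (simp add: k_def)
    \<comment> \<open>As 0.84^3 < 0.6 < x^3. The last step down from above 0.6 then lands above 0.84
      * 0.6 = 0.504, the second entry of the minimum.\<close>
    moreover have "84/100 \<le> x"
    proof (rule ccontr)
      assume "\<not> 84/100 \<le> x"
      then have "x ^ 3 \<le> (84/100) ^ 3" using x0 by (intro power_mono) auto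
      then show False using False by (simp add: power_divide)
    qed
    ultimately have "(84/100) * (6/10) \<le> x * x ^ (k - 1)" by (intro mult_mono) auto
    also have "\<dots> = x ^ k" using k3 by (simp flip: power_Suc)
    finally show ?thesis using k kK k3 by (intro bexI[of _ k]) (auto simp: b0_def)
  qed
  then obtain k where k: "k \<in> {3..K}" "b0 \<le> x ^ k" "x ^ k \<le> 6/10" by blast
  have "root k b0 \<le> root k (x ^ k)" "root k (x ^ k) \<le> root k (6/10)" using k by auto
  moreover have "root k (x ^ k) = x" using k x0 by (intro real_root_power_cancel) auto
  ultimately show ?thesis using k unfolding b0_def by auto
qed

text \<open>The first N coordinates split the sign space into 2^N cylinders \<open>A S\<close> of
  measure 2^(-N), and the integrand is constant on each.\<close>

lemma sign_average_eq_integral: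
  "sign_average N F x = (\<integral>a. F (\<Sum>i<N. a i * x ^ i) \<partial>sign_space)"
proof -
  interpret S: prob_space sign_space by (rule prob_space_sign_space)
  let ?U = "\<lambda>_::nat. uniform_count_measure {-1, 1::real}"
  interpret U: product_prob_space ?U UNIV
    by (intro product_prob_spaceI prob_space_uniform_count_measure) auto
  define A where "A S = prod_emb UNIV ?U {..<N} (\<Pi>\<^sub>E i\<in>{..<N}. {sg S i})" for S
  have A_sets: "A S \<in> sets sign_space" for S
    unfolding A_def sign_space_def by (intro sets_PiM_I) (auto simp: sets_uniform_count_measure sg_def)
  have "measure sign_space (A S) = (\<Prod>i<N. measure (?U i) {sg S i})" for S
    unfolding A_def sign_space_def by (intro U.measure_PiM_emb) (auto simp: sets_uniform_count_measure sg_def)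
  then have mA: "measure sign_space (A S) = 1 / 2 ^ N" for S
    by (simp add: measure_uniform_count_measure sg_def power_one_over)
  have memA: "a \<in> A S \<longleftrightarrow> (\<forall>i<N. a i = sg S i)" if "a \<in> space sign_space" for a S
    using that by (auto simp: A_def prod_emb_def sign_space_def space_PiM restrict_PiE_iff PiE_iff)
  have "(\<integral>a. F (\<Sum>i<N. a i * x ^ i) \<partial>sign_space) =
      (\<integral>a. (\<Sum>S\<in>Pow {..<N}. indicator (A S) a * F (psum N (sg S) 0 x)) \<partial>sign_space)"
  proof (rule Bochner_Integration.integral_cong[OF refl])
    fix a assume a: "a \<in> space sign_space"
    define T where "T = {i. i < N \<and> a i = 1}"
    have aT: "a i = sg T i" if "i < N" for i
      using a that by (auto simp: space_sign_space sg_def T_def)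
    have uniq: "S = T" if "S \<in> Pow {..<N}" "a \<in> A S" for S
    proof -
      have "\<forall>i<N. sg S i = sg T i" using that aT memA[OF a, of S] by auto
      then show ?thesis using that(1) by (auto simp: sg_def T_def split: if_splits)
    qed
    have "a \<in> A T" using memA[OF a] aT by auto
    then have iff: "a \<in> A S \<longleftrightarrow> S = T" if "S \<in> Pow {..<N}" for S using uniq[OF that] by blast
    have "(\<Sum>S\<in>Pow {..<N}. indicator (A S) a * F (psum N (sg S) 0 x)) =
       (\<Sum>S\<in>Pow {..<N}. if S = T then F (psum N (sg T) 0 x) else 0)"
      by (intro sum.cong refl) (simp only: indicator_def iff, simp)
    also have "\<dots> = F (psum N (sg T) 0 x)" by (subst sum.delta) (auto simp: T_def)
    also have "psum N (sg T) 0 x = (\<Sum>i<N. a i * x ^ i)" unfolding psum_def using aT by (intro sum.cong) auto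
    finally show "F (\<Sum>i<N. a i * x ^ i) = (\<Sum>S\<in>Pow {..<N}. indicator (A S) a * F (psum N (sg S) 0 x))" by simp
  qed
  also have "\<dots> = (\<Sum>S\<in>Pow {..<N}. \<integral>a. indicator (A S) a * F (psum N (sg S) 0 x) \<partial>sign_space)"
    using A_sets by (intro Bochner_Integration.integral_sum integrable_mult_left integrable_real_indicator)
      (auto simp: S.emeasure_eq_measure)
  also have "\<dots> = (\<Sum>S\<in>Pow {..<N}. F (psum N (sg S) 0 x) / 2 ^ N)"
    using A_sets by (simp add: mA)
  finally show ?thesis by (simp add: sign_average_def sum_divide_distrib)
qed

text \<open>Two errors tend to 0: replacing \<open>F N\<close> by \<phi> costs at most \<delta> N,
  and truncating the series costs C times the power \<alpha> of the geometric tail x^N / (1 -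
  x).\<close>

lemma sign_average_tendsto:
  fixes x :: real and F :: "nat \<Rightarrow> real \<Rightarrow> real"
  assumes x: "0 < x" "x < 1" and \<phi>: "\<And>x y. \<bar>\<phi> x - \<phi> y\<bar> \<le> C * \<bar>x - y\<bar> powr \<alpha>" and \<alpha>: "0 < \<alpha>"
    and F: "\<And>N y. \<bar>F N y - \<phi> y\<bar> \<le> \<delta> N" and \<delta>: "\<delta> \<longlonglongrightarrow> 0"
    and cF: "\<And>N. continuous_on UNIV (F N)" and c\<phi>: "continuous_on UNIV \<phi>"
  shows "(\<lambda>N. sign_average N (F N) x) \<longlonglongrightarrow> (\<integral>y. \<phi> y \<partial>(bernoulli_convolution x))"
proof -
  interpret S: prob_space sign_space by (rule prob_space_sign_space)
  define X where "X a = (\<Sum>m. a m * x ^ m)" for a :: "nat \<Rightarrow> real"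
  define XN where "XN N a = (\<Sum>i<N. a i * x ^ i)" for a :: "nat \<Rightarrow> real" and N
  have mX: "X \<in> borel_measurable sign_space" unfolding X_def[abs_def] by (rule measurable_bernoulli_series)
  have mc: "(\<lambda>a. a m) \<in> borel_measurable sign_space" for m
  proof -
    have "(\<lambda>a. a m) \<in> measurable sign_space (uniform_count_measure {-1, 1})"
      unfolding sign_space_def by (rule measurable_component_singleton) simp
    moreover have "(\<lambda>x. x) \<in> borel_measurable (uniform_count_measure {-1, 1 :: real})"
      by (auto simp: measurable_def space_uniform_count_measure sets_uniform_count_measure)
    ultimately show ?thesis by (rule measurable_compose)
  qed
  have mXN: "XN N \<in> borel_measurable sign_space" for N
    unfolding XN_def[abs_def] using mc by (intro borel_measurable_sum borel_measurable_times) auto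
  have m\<phi>: "\<phi> \<in> borel_measurable borel" and mF: "F N \<in> borel_measurable borel" for N
    using c\<phi> cF by (auto intro: borel_measurable_continuous_onI)
  have C: "C \<ge> 0" using \<phi>[of 0 1] by simp
  have geo: "(\<lambda>m. x ^ m) sums (1 / (1 - x))" using x by (intro geometric_sums) auto
  have ab: "\<bar>a m * x ^ m\<bar> \<le> x ^ m" if "a \<in> space sign_space" for a m
  proof -
    have "a m = -1 \<or> a m = 1" using that by (auto simp: space_sign_space)
    then show ?thesis using x by (auto simp: abs_mult)
  qed
  have sm: "summable (\<lambda>m. a m * x ^ m)" if "a \<in> space sign_space" for a
    using ab[OF that] by (intro summable_comparison_test'[OF sums_summable[OF geo]]) auto
  have tail: "\<bar>X a - XN N a\<bar> \<le> x ^ N / (1 - x)" if a: "a \<in> space sign_space" for a N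
  proof -
    have "X a - XN N a = (\<Sum>m. a (m + N) * x ^ (m + N))"
      unfolding X_def XN_def using suminf_split_initial_segment[OF sm[OF a], of N] by simp
    also have "\<bar>\<dots>\<bar> \<le> (\<Sum>m. x ^ (m + N))"
      using ab[OF a] norm_suminf_le[of "\<lambda>m. a (m + N) * x ^ (m + N)" "\<lambda>m. x ^ (m + N)"]
        summable_ignore_initial_segment[OF sums_summable[OF geo], of N] by simp
    also have "\<dots> = x ^ N / (1 - x)"
      using suminf_mult[OF sums_summable[OF geo], of "x ^ N"] sums_unique[OF geo, symmetric]
      by (simp add: power_add mult.commute)
    finally show ?thesis .
  qed
  define B where "B = 1 / (1 - x)"
  have X_le: "\<bar>X a\<bar> \<le> B" if a: "a \<in> space sign_space" for a
    using tail[OF a, of 0] by (simp add: XN_def B_def)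
  have XN_le: "\<bar>XN N a\<bar> \<le> 2 * B" if a: "a \<in> space sign_space" for a N
  proof -
    have "x ^ N / (1 - x) \<le> B" unfolding B_def using x by (intro divide_right_mono power_le_one) auto
    then show ?thesis using tail[OF a, of N] X_le[OF a] by linarith
  qed
  \<comment> \<open>A Hoelder function may be unbounded on the line; integrability comes from the
    series and its truncations staying in a compact interval.\<close>
  have bdd: "\<exists>L. \<forall>y. \<bar>y\<bar> \<le> 2 * B \<longrightarrow> \<bar>f y\<bar> \<le> L" if "continuous_on UNIV f" for f :: "real \<Rightarrow> real"
  proof -
    have "compact (f ` {-(2 * B)..2 * B})"
      by (intro compact_continuous_image continuous_on_subset[OF that]) auto
    then have "bounded (f ` {-(2 * B)..2 * B})" by (rule compact_imp_bounded)
    then show ?thesis by (fastforce simp: bounded_iff abs_le_iff)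
  qed
  have i1: "integrable sign_space (\<lambda>a. \<phi> (X a))"
  proof -
    obtain L where L: "\<And>y. \<bar>y\<bar> \<le> 2 * B \<Longrightarrow> \<bar>\<phi> y\<bar> \<le> L" using bdd[OF c\<phi>] by blast
    have "B \<ge> 0" using x by (simp add: B_def)
    show ?thesis
      by (rule S.integrable_const_bound[where B = L]) (use X_le L \<open>B \<ge> 0\<close> measurable_compose[OF mX m\<phi>] in \<open>force intro!: AE_I2\<close>)+
  qed
  have i2: "integrable sign_space (\<lambda>a. F N (XN N a))" for N
  proof -
    obtain L where L: "\<And>y. \<bar>y\<bar> \<le> 2 * B \<Longrightarrow> \<bar>F N y\<bar> \<le> L" using bdd[OF cF] by blast
    show ?thesis
      by (rule S.integrable_const_bound[where B = L]) (use XN_le L measurable_compose[OF mXN mF] in \<open>auto intro!: AE_I2\<close>)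
  qed
  have eq1: "(\<integral>y. \<phi> y \<partial>(bernoulli_convolution x)) = (\<integral>a. \<phi> (X a) \<partial>sign_space)"
    unfolding bernoulli_convolution_def X_def[symmetric]
    by (subst integral_distr) (use mX m\<phi> in auto)
  have eq2: "sign_average N (F N) x = (\<integral>a. F N (XN N a) \<partial>sign_space)" for N
    by (simp add: sign_average_eq_integral XN_def)
  have bound: "\<bar>sign_average N (F N) x - (\<integral>y. \<phi> y \<partial>(bernoulli_convolution x))\<bar> \<le> \<delta> N + C * (x ^ N / (1 - x)) powr \<alpha>" for N
  proof -
    have "\<bar>\<integral>a. F N (XN N a) - \<phi> (X a) \<partial>sign_space\<bar> \<le> (\<integral>a. \<bar>F N (XN N a) - \<phi> (X a)\<bar> \<partial>sign_space)"
      by (rule integral_abs_bound)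
    also have "\<dots> \<le> (\<integral>a. \<delta> N + C * (x ^ N / (1 - x)) powr \<alpha> \<partial>sign_space)"
    proof (rule integral_mono)
      fix a assume a: "a \<in> space sign_space"
      have "\<bar>X a - XN N a\<bar> powr \<alpha> \<le> (x ^ N / (1 - x)) powr \<alpha>"
        using tail[OF a, of N] \<alpha> by (intro powr_mono2) auto
      then have "C * \<bar>XN N a - X a\<bar> powr \<alpha> \<le> C * (x ^ N / (1 - x)) powr \<alpha>"
        using C by (simp add: abs_minus_commute mult_left_mono)
      then show "\<bar>F N (XN N a) - \<phi> (X a)\<bar> \<le> \<delta> N + C * (x ^ N / (1 - x)) powr \<alpha>"
        using F[of N "XN N a"] \<phi>[of "XN N a" "X a"] by linarith
    qed (use i1 i2 in auto)
    finally show ?thesis using i1 i2 by (simp add: eq1 eq2 S.prob_space)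
  qed
  have "(\<lambda>N. \<delta> N + C * (x ^ N / (1 - x)) powr \<alpha>) \<longlonglongrightarrow> 0 + C * (0 / (1 - x)) powr \<alpha>"
    using x \<alpha> by (intro tendsto_intros \<delta> tendsto_powr' LIMSEQ_power_zero) auto
  then have "(\<lambda>N. \<delta> N + C * (x ^ N / (1 - x)) powr \<alpha>) \<longlonglongrightarrow> 0" by simp
  then have "(\<lambda>N. sign_average N (F N) x - (\<integral>y. \<phi> y \<partial>(bernoulli_convolution x))) \<longlonglongrightarrow> 0"
    by (rule Lim_null_comparison[rotated]) (use bound in auto)
  then show ?thesis by (simp add: LIM_zero_iff)
qed

section \<open>Auxiliary facts for the limit: exponent, continuity, uniform derivative
  bounds\<close>

lemma exponent_exists:
  fixes c :: real
  assumes "1/2 < c"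
  obtains s where "0 < s" "s \<le> 1" "1 < 2 * c powr (1 + s)"
proof -
  have "((\<lambda>s. 2 * c powr (1 + s)) \<longlongrightarrow> 2 * c powr (1 + 0)) (at_right 0)"
    using assms by (intro tendsto_intros) auto
  then have "\<forall>\<^sub>F s in at_right 0. 1 < 2 * c powr (1 + s)"
    by (rule order_tendstoD(1)) (use assms in simp)
  moreover have "\<forall>\<^sub>F s in at_right 0. s \<in> {0<..<1::real}"
    by (rule eventually_at_right_real) simp
  ultimately have "\<forall>\<^sub>F s in at_right (0::real). 1 < 2 * c powr (1 + s) \<and> s \<in> {0<..<1}"
    by (rule eventually_conj)
  from eventually_happens[OF this] show ?thesis using that by force
qed

lemma isCont_holder:
  fixes \<phi> :: "real \<Rightarrow> real"
  assumes \<phi>: "\<And>x y. \<bar>\<phi> x - \<phi> y\<bar> \<le> C * \<bar>x - y\<bar> powr \<alpha>" and "0 < \<alpha>"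
  shows "isCont \<phi> x"
proof -
  have "((\<lambda>y. C * \<bar>y - x\<bar> powr \<alpha>) \<longlongrightarrow> C * \<bar>x - x\<bar> powr \<alpha>) (at x)"
    using \<open>0 < \<alpha>\<close> by (intro tendsto_intros tendsto_powr') auto
  then have "((\<lambda>y. C * \<bar>y - x\<bar> powr \<alpha>) \<longlongrightarrow> 0) (at x)" by simp
  then have "((\<lambda>y. \<phi> y - \<phi> x) \<longlongrightarrow> 0) (at x)"
    by (rule Lim_null_comparison[rotated]) (use \<phi> in auto)
  then show ?thesis by (simp add: isCont_def LIM_zero_iff)
qed

lemma sign_average_diff:
  "sign_average N (\<lambda>y. F y - G y) x = sign_average N F x - sign_average N G x"
  by (simp add: sign_average_def sum_subtractf diff_divide_distrib)

text \<open>The factor 2 bounds 1 / x. The estimate is uniform in N, so the low-frequency part is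
  Lipschitz with one constant for all truncations.\<close>

lemma abs_sign_average_deriv_le:
  assumes "1/2 \<le> x" "x \<le> b" "b < 1" and f: "\<And>y. \<bar>y\<bar> \<le> cubic_series b \<Longrightarrow> \<bar>f y\<bar> \<le> B"
  shows "\<bar>sign_average_deriv N f x\<bar> \<le> 2 * B * cubic_series b"
proof -
  have "\<bar>sign_average_deriv N f x\<bar> \<le> (\<Sum>S\<in>Pow {..<N}. \<bar>f (psum N (sg S) 0 x) * psum N (sg S) 1 x / x\<bar>) / 2 ^ N"
    unfolding sign_average_deriv_def abs_divide[of _ "2 ^ N"] by (intro frac_le sum_abs) (auto intro: sum_nonneg)
  also have "\<dots> \<le> (\<Sum>S\<in>Pow {..<N}. B * cubic_series b / (1/2)) / 2 ^ N"
  proof (intro divide_right_mono sum_mono)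
    fix S
    have p: "\<bar>psum N (sg S) r x\<bar> \<le> cubic_series b" if "r \<le> 3" for r
      using assms that by (intro abs_psum_le' abs_sg) auto
    have "\<bar>f (psum N (sg S) 0 x)\<bar> \<le> B" using f p by simp
    then show "\<bar>f (psum N (sg S) 0 x) * psum N (sg S) 1 x / x\<bar> \<le> B * cubic_series b / (1/2)"
      unfolding abs_divide abs_mult using p[of 1] assms
      by (intro frac_le mult_mono mult_nonneg_nonneg) auto
  qed simp
  also have "\<dots> = 2 * B * cubic_series b" by (simp add: card_Pow)
  finally show ?thesis .
qed

lemma sum_geometric_tail_le:
  fixes q :: real
  assumes "0 \<le> q" "q < 1"
  shows "(\<Sum>j=m..<n. q ^ (j + 1)) \<le> q ^ m / (1 - q)"
proof -
  have "(\<Sum>j=m..<n. q ^ (j + 1)) = (\<Sum>i<n - m. q ^ m * q ^ (i + 1))"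
    by (subst sum.atLeastLessThan_shift_0) (simp add: atLeast0LessThan power_add mult_ac)
  also have "\<dots> \<le> (\<Sum>i<n - m. q ^ m * q ^ i)"
    using assms by (intro sum_mono mult_left_mono power_decreasing) auto
  also have "\<dots> = q ^ m * (\<Sum>i<n - m. q ^ i)" by (simp add: sum_distrib_left)
  also have "\<dots> \<le> q ^ m * (1 / (1 - q))"
    using assms geometric_sums[of q] sum_le_suminf[of "\<lambda>i. q ^ i" "{..<n - m}"]
    by (intro mult_left_mono) (auto simp: sums_iff)
  finally show ?thesis by simp
qed

text \<open>For a fixed finite family P the sum of increments converges with N, and \<delta> is
  independent of N. Using e / 2 restores the strict inequality in the limit.\<close>

lemma absolutely_continuous_on_limit:
  fixes H :: "nat \<Rightarrow> real \<Rightarrow> real"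
  assumes lim: "\<And>x. x \<in> I \<Longrightarrow> (\<lambda>N. H N x) \<longlonglongrightarrow> h x"
    and unif: "\<And>e. e > 0 \<Longrightarrow> \<exists>\<delta>>0. \<forall>\<^sub>F N in sequentially. \<forall>P. finite P \<longrightarrow>
        (\<forall>(u, v)\<in>P. u < v \<and> {u..v} \<subseteq> I) \<longrightarrow> disjoint_family_on (\<lambda>(u, v). {u<..<v}) P \<longrightarrow>
        (\<Sum>(u, v)\<in>P. v - u) < \<delta> \<longrightarrow> (\<Sum>(u, v)\<in>P. \<bar>H N v - H N u\<bar>) \<le> e"
  shows "absolutely_continuous_on I h"
  unfolding absolutely_continuous_on_def
proof (intro allI impI)
  fix e :: real assume "e > 0"
  with unif[of "e / 2"] obtain \<delta> where \<delta>: "\<delta> > 0" and ev: "\<forall>\<^sub>F N in sequentially. \<forall>P. finite P \<longrightarrow>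
        (\<forall>(u, v)\<in>P. u < v \<and> {u..v} \<subseteq> I) \<longrightarrow> disjoint_family_on (\<lambda>(u, v). {u<..<v}) P \<longrightarrow>
        (\<Sum>(u, v)\<in>P. v - u) < \<delta> \<longrightarrow> (\<Sum>(u, v)\<in>P. \<bar>H N v - H N u\<bar>) \<le> e / 2"
    by auto
  have "(\<Sum>(u, v)\<in>P. \<bar>h v - h u\<bar>) < e" if P: "finite P" "\<forall>(u, v)\<in>P. u < v \<and> {u..v} \<subseteq> I"
    "disjoint_family_on (\<lambda>(u, v). {u<..<v}) P" "(\<Sum>(u, v)\<in>P. v - u) < \<delta>" for P
  proof -
    have mem: "fst p \<in> I" "snd p \<in> I" if "p \<in> P" for p
    proof -
      have "fst p < snd p" "{fst p..snd p} \<subseteq> I" using P(2) that by (auto simp: case_prod_beta)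
      then show "fst p \<in> I" "snd p \<in> I" by auto
    qed
    have t: "(\<lambda>N. \<Sum>p\<in>P. \<bar>H N (snd p) - H N (fst p)\<bar>) \<longlonglongrightarrow> (\<Sum>p\<in>P. \<bar>h (snd p) - h (fst p)\<bar>)"
      by (intro tendsto_intros lim mem)
    have "\<forall>\<^sub>F N in sequentially. (\<Sum>p\<in>P. \<bar>H N (snd p) - H N (fst p)\<bar>) \<le> e / 2"
      using ev by eventually_elim (use P in \<open>simp add: case_prod_beta\<close>)
    from tendsto_upperbound[OF t this] have "(\<Sum>p\<in>P. \<bar>h (snd p) - h (fst p)\<bar>) \<le> e / 2" by simp
    then show ?thesis using \<open>e > 0\<close> by (simp add: case_prod_beta)
  qed
  then show "\<exists>\<delta>>0. \<forall>P. finite P \<longrightarrow> (\<forall>(u, v)\<in>P. u < v \<and> {u..v} \<subseteq> I) \<longrightarrow>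
        disjoint_family_on (\<lambda>(u, v). {u<..<v}) P \<longrightarrow> (\<Sum>(u, v)\<in>P. v - u) < \<delta> \<longrightarrow>
        (\<Sum>(u, v)\<in>P. \<bar>h v - h u\<bar>) < e"
    using \<delta> by blast
qed

lemma absolutely_continuous_on_empty: "absolutely_continuous_on {} f"
proof -
  have "P = {}" if "\<forall>(u, v)\<in>P. u < v \<and> {u..v} \<subseteq> {}" for P :: "(real \<times> real) set"
    using that by fastforce
  note empty = this
  show ?thesis
    unfolding absolutely_continuous_on_def
  proof (intro allI impI exI[of _ "1::real"] conjI)
    fix e :: real and P :: "(real \<times> real) set"
    assume "e > 0" "\<forall>(u, v)\<in>P. u < v \<and> {u..v} \<subseteq> {}"
    then show "(\<Sum>(u, v)\<in>P. \<bar>f v - f u\<bar>) < e" using empty[of P] by simp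
  qed simp
qed

text \<open>\<open>H N\<close> mollifies \<phi> at scale 2^(-J N) and averages over N signs. It
  telescopes into a low-frequency part \<open>G N\<close>, which is uniformly Lipschitz, and dyadic
  pieces whose variation is controlled window by window by a geometric series in q.\<close>

lemma absolutely_continuous_bernoulli:
  fixes \<epsilon> s C \<alpha> :: real and K :: nat and W :: "nat \<Rightarrow> real" and \<phi> :: "real \<Rightarrow> real"
  defines "I \<equiv> {2 powr (- 1 / 3) + \<epsilon> <..< 1 - \<epsilon>}" and "b0 \<equiv> min (1/2 + \<epsilon> ^ 3) (504/1000)"
  assumes \<epsilon>: "0 < \<epsilon>" "2 powr (- 1 / 3) + \<epsilon> < 1 - \<epsilon>" and K: "(1 - \<epsilon>) ^ K \<le> 6/10" "3 \<le> K"
    and s: "0 < s"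
    and W: "\<And>k. k \<ge> 1 \<Longrightarrow> window_bound s b0 k (W k)"
    and \<phi>: "\<And>x y. \<bar>\<phi> x - \<phi> y\<bar> \<le> C * \<bar>x - y\<bar> powr \<alpha>" and C: "C \<ge> 0" and \<alpha>: "0 < \<alpha>" "1 - s / 4 \<le> \<alpha>"
  shows "absolutely_continuous_on I (\<lambda>l. \<integral>x. \<phi> x \<partial>(bernoulli_convolution l))"
proof -
  define b where "b = 1 - \<epsilon>"
  define Z where "Z = cubic_series b"
  have "2 powr (- 1) \<le> (2::real) powr (- 1 / 3)" by (intro powr_mono) auto
  then have half: "1/2 \<le> (2::real) powr (- 1 / 3)" by (simp add: powr_minus_divide)
  have b: "0 \<le> b" "b < 1" using \<epsilon> half unfolding b_def by linarith+
  have Z1: "Z \<ge> 1" unfolding Z_def by (rule cubic_series_ge_1[OF b])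
  have I: "1/2 \<le> x" "x \<le> b" "0 < x" "x < 1" if "x \<in> I" for x
  proof -
    have "2 powr (- 1 / 3) + \<epsilon> < x" "x < 1 - \<epsilon>" using that by (auto simp: I_def)
    then show "1/2 \<le> x" "x \<le> b" "0 < x" "x < 1" using half \<epsilon>(1) unfolding b_def by linarith+
  qed
  have b0: "1/2 < b0" "b0 \<le> 6/10" 
    using \<epsilon>(1) min.cobounded2[of "1/2 + \<epsilon> ^ 3" "504/1000"] unfolding b0_def by simp_all
  have c\<phi>: "isCont \<phi> x" for x by (rule isCont_holder[OF \<phi> \<alpha>(1)])
  obtain F1 where F1: "\<And>x. (F1 has_real_derivative \<phi> x) (at x)" using antiderivative_exists[OF c\<phi>] by blast
  obtain F2 where F2: "\<And>x. (F2 has_real_derivative F1 x) (at x)"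
    using antiderivative_exists[of F1, OF DERIV_isCont[OF F1]] by blast
  \<comment> \<open>This ties scale to truncation: every j < J N satisfies K (2 j + 2) <= N, so
    there are enough signs for each k up to K.\<close>
  define J where "J N = N div (2 * K)" for N
  define H where "H N x = sign_average N (second_quotient F2 ((1/2) ^ J N)) x" for N x
  have J_lim: "filterlim J at_top sequentially"
    unfolding J_def[abs_def] using K by (intro filterlim_at_top_div_const_nat) auto
  show ?thesis
  proof (rule absolutely_continuous_on_limit[where H = H])
    fix x assume x: "x \<in> I"
    have "(\<lambda>j. 2 * C * ((1/2) ^ j) powr \<alpha>) \<longlonglongrightarrow> 2 * C * 0 powr \<alpha>"
      using \<alpha> by (intro tendsto_intros tendsto_powr' LIMSEQ_power_zero) auto
    then have "(\<lambda>j. 2 * C * ((1/2) ^ j) powr \<alpha>) \<longlonglongrightarrow> 0" by simp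
    from filterlim_compose[OF this J_lim]
    have lim: "(\<lambda>N. 2 * C * ((1/2) ^ J N) powr \<alpha>) \<longlonglongrightarrow> 0" .
    show "(\<lambda>N. H N x) \<longlonglongrightarrow> (\<integral>y. \<phi> y \<partial>(bernoulli_convolution x))"
      unfolding H_def
    proof (rule sign_average_tendsto[OF I(3,4)[OF x] \<phi> \<alpha>(1) _ lim])
      show "\<bar>second_quotient F2 ((1/2) ^ J N) y - \<phi> y\<bar> \<le> 2 * C * ((1/2) ^ J N) powr \<alpha>" for N y
        by (rule second_quotient_approx[OF F2 F1 \<phi> \<alpha>(1) _ C]) simp
      show "continuous_on UNIV (second_quotient F2 ((1/2) ^ J N))" for N
        by (rule continuous_on_second_quotient[OF F2])
      show "continuous_on UNIV \<phi>" using c\<phi> by (auto intro: continuous_at_imp_continuous_on)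
    qed
  next
    fix e :: real assume e: "e > 0"
    define q where "q = (1/2::real) powr (s / 4)"
    have q: "0 < q" "q < 1" using s powr_less_mono2[of "s / 4" "1/2" 1] unfolding q_def by auto
    have qpow: "((1/2::real) ^ n) powr (s / 4) = q ^ n" for n
      unfolding q_def by (simp add: powr_powr mult.commute flip: powr_realpow)
    define Wt where "Wt = (\<Sum>k\<in>{3..K}. W k)"
    have Wt: "Wt \<ge> 0" unfolding Wt_def using W by (intro sum_nonneg) (auto simp: window_bound_def)
    have "(\<lambda>n. C * Wt * (q ^ n / (1 - q))) \<longlonglongrightarrow> C * Wt * (0 / (1 - q))"
      using q by (intro tendsto_intros LIMSEQ_power_zero) auto
    then have "\<forall>\<^sub>F n in sequentially. C * Wt * (q ^ n / (1 - q)) < e / 2"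
      using e by (intro order_tendstoD(2)) auto
    \<comment> \<open>The cut between low and high frequencies is fixed first, so that the tail of
      all later pieces is below e / 2; L and then \<delta> may depend on it.\<close>
    from eventually_happens[OF this] obtain J0 where J0: "C * Wt * (q ^ J0 / (1 - q)) < e / 2"
      by auto
    define f where "f = second_quotient F1 ((1/2) ^ J0)"
    have "compact (f ` {-Z..Z})"
      unfolding f_def by (intro compact_continuous_image continuous_on_second_quotient[OF F1]) auto
    then have "bounded (f ` {-Z..Z})" by (rule compact_imp_bounded)
    then obtain B where B: "\<And>y. \<bar>y\<bar> \<le> Z \<Longrightarrow> \<bar>f y\<bar> \<le> B"
      by (fastforce simp: bounded_iff abs_le_iff)
    have B0: "B \<ge> 0" using B[of 0] Z1 by fastforce
    define L where "L = 2 * B * Z"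
    have L0: "L \<ge> 0" using B0 Z1 by (simp add: L_def)
    \<comment> \<open>L + 1 avoids division by 0 and keeps L * \<delta> at most e / 2.\<close>
    define \<delta> where "\<delta> = e / (2 * (L + 1))"
    have \<delta>: "\<delta> > 0" using e L0 by (simp add: \<delta>_def)
    define G where "G N x = sign_average N (second_quotient F2 ((1/2) ^ J0)) x" for N x
    define dd where "dd j y = second_quotient F2 ((1/2) ^ (j + 1)) y - second_quotient F2 (2 * (1/2) ^ (j + 1)) y" for j :: nat and y
    define dd1 where "dd1 j y = second_quotient F1 ((1/2) ^ (j + 1)) y - second_quotient F1 (2 * (1/2) ^ (j + 1)) y" for j :: nat and y
    have est: "(\<Sum>(u, v)\<in>P. \<bar>H N v - H N u\<bar>) \<le> e"
      if N: "J0 \<le> J N" and P: "finite P" "\<forall>(u, v)\<in>P. u < v \<and> {u..v} \<subseteq> I"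
        "disjoint_family_on (\<lambda>(u, v). {u<..<v}) P" "(\<Sum>(u, v)\<in>P. v - u) < \<delta>" for N P
    proof -
      have Hx: "H N x = G N x + (\<Sum>j=J0..<J N. sign_average N (dd j) x)" for x
      proof -
        have "(\<Sum>j=J0..<J N. sign_average N (dd j) x) =
          (\<Sum>j=J0..<J N. sign_average N (second_quotient F2 ((1/2) ^ Suc j)) x - sign_average N (second_quotient F2 ((1/2) ^ j)) x)"
          unfolding dd_def[abs_def] sign_average_diff by simp
        also have "\<dots> = H N x - G N x"
          unfolding H_def G_def
          using sum_Suc_diff'[OF N, of "\<lambda>j. sign_average N (second_quotient F2 ((1/2) ^ j)) x"] by simp
        finally show ?thesis by simp
      qed
      have Glip: "\<bar>G N v - G N u\<bar> \<le> L * (v - u)" if uv: "u < v" "{u..v} \<subseteq> I" for u v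
      proof -
        have d: "(G N has_real_derivative sign_average_deriv N f x) (at x)" if "u \<le> x" "x \<le> v" for x
          unfolding G_def[abs_def] f_def using that uv(2) I(3)
          by (intro has_real_derivative_sign_average has_real_derivative_second_quotient F2) auto
        obtain z where z: "u < z" "z < v" "G N v - G N u = (v - u) * sign_average_deriv N f z"
          using MVT2[OF uv(1) d] by blast
        have "z \<in> I" using z uv by auto
        then have "\<bar>sign_average_deriv N f z\<bar> \<le> L"
          unfolding L_def Z_def using I B b Z_def by (intro abs_sign_average_deriv_le) auto
        then show ?thesis unfolding z(3) using uv by (simp add: abs_mult mult.commute mult_right_mono)
      qed
      have "(\<Sum>(u, v)\<in>P. \<bar>G N v - G N u\<bar>) \<le> (\<Sum>(u, v)\<in>P. L * (v - u))"
        using P(2) Glip by (intro sum_mono) (auto simp: case_prod_beta)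
      also have "\<dots> = L * (\<Sum>(u, v)\<in>P. v - u)" by (simp add: sum_distrib_left case_prod_beta)
      also have "\<dots> \<le> L * \<delta>" using P(4) L0 by (intro mult_left_mono) auto
      also have "\<dots> \<le> e / 2" using L0 e by (simp add: \<delta>_def field_simps)
      finally have 1: "(\<Sum>(u, v)\<in>P. \<bar>G N v - G N u\<bar>) \<le> e / 2" .
      have 2: "(\<Sum>(u, v)\<in>P. \<bar>sign_average N (dd j) v - sign_average N (dd j) u\<bar>) \<le> C * Wt * q ^ (j + 1)"
        if j: "j \<in> {J0..<J N}" for j
      proof -
        have "2 * K * (j + 1) \<le> 2 * K * J N" using j by (intro mult_left_mono) auto
        also have "\<dots> \<le> N" unfolding J_def by (rule times_div_less_eq_dividend)
        finally have KN: "K * (2 * j + 2) \<le> N" by (simp add: algebra_simps)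
        have rt: "{root k b0..root k (6/10)} \<subseteq> {1/2..1}" if "k \<in> {3..K}" for k
        proof -
          have "(1/2) ^ k \<le> (1/2::real) ^ 1" using that by (intro power_decreasing) auto
          then have "root k ((1/2) ^ k) \<le> root k b0" using that b0 by (intro real_root_le_mono) auto
          moreover have "root k ((1/2) ^ k) = 1/2" using that by (intro real_root_power_cancel) auto
          moreover have "root k (6/10) \<le> 1" using that by simp
          ultimately show ?thesis by auto
        qed
        have cover: "I \<subseteq> (\<Union>k\<in>{3..K}. {root k b0..root k (6/10)})"
        proof
          fix x assume "x \<in> I"
          then show "x \<in> (\<Union>k\<in>{3..K}. {root k b0..root k (6/10)})"
            using window_cover[OF \<epsilon>(1) _ _ K, of x] unfolding I_def b0_def by auto
        qed
        have "(\<Sum>(u, v)\<in>P. \<bar>sign_average N (dd j) v - sign_average N (dd j) u\<bar>) \<le>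
          (\<Sum>k\<in>{3..K}. integral {root k b0..root k (6/10)} (\<lambda>x. \<bar>sign_average_deriv N (dd1 j) x\<bar>))"
        proof (rule sum_increments_le[where c = "1/2" and d = 1, OF _ _ _ P(1-3) _ cover _ rt])
          show "(sign_average N (dd j) has_real_derivative sign_average_deriv N (dd1 j) x) (at x)" if "x > 0" for x
            unfolding dd_def[abs_def] dd1_def[abs_def] using that
            by (intro has_real_derivative_sign_average DERIV_diff has_real_derivative_second_quotient F2)
          show "continuous_on {0<..} (sign_average_deriv N (dd1 j))"
            unfolding dd1_def[abs_def]
            by (intro continuous_on_sign_average_deriv continuous_intros continuous_on_second_quotient[OF F1]) auto
          show "I \<subseteq> {1/2..1}" using I by fastforce
        qed auto
        also have "\<dots> \<le> (\<Sum>k\<in>{3..K}. C * W k * q ^ (j + 1))"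
        proof (rule sum_mono)
          fix k assume k: "k \<in> {3..K}"
          have "k * (2 * j + 2) \<le> K * (2 * j + 2)" using k by (intro mult_right_mono) auto
          then have "k * (2 * j + 2) \<le> N" using KN by linarith
          then show "integral {root k b0..root k (6/10)} (\<lambda>x. \<bar>sign_average_deriv N (dd1 j) x\<bar>) \<le> C * W k * q ^ (j + 1)"
            unfolding dd1_def[abs_def] qpow[symmetric] 
            using k by (intro window_boundD[OF W F1 \<phi> C \<alpha>(2)]) auto
        qed
        also have "\<dots> = C * Wt * q ^ (j + 1)" by (simp add: Wt_def sum_distrib_left sum_distrib_right)
        finally show ?thesis .
      qed
      have "(\<Sum>(u, v)\<in>P. \<bar>H N v - H N u\<bar>) \<le> (\<Sum>(u, v)\<in>P. \<bar>G N v - G N u\<bar> +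
          (\<Sum>j=J0..<J N. \<bar>sign_average N (dd j) v - sign_average N (dd j) u\<bar>))"
      proof (intro sum_mono, clarify)
        fix u v
        have "H N v - H N u = (G N v - G N u) + (\<Sum>j=J0..<J N. sign_average N (dd j) v - sign_average N (dd j) u)"
          unfolding Hx by (simp add: sum_subtractf)
        then show "\<bar>H N v - H N u\<bar> \<le> \<bar>G N v - G N u\<bar> + (\<Sum>j=J0..<J N. \<bar>sign_average N (dd j) v - sign_average N (dd j) u\<bar>)"
          by (simp only:) (rule order_trans[OF abs_triangle_ineq add_left_mono[OF sum_abs]])
      qed
      also have "\<dots> = (\<Sum>(u, v)\<in>P. \<bar>G N v - G N u\<bar>) +
          (\<Sum>j=J0..<J N. \<Sum>(u, v)\<in>P. \<bar>sign_average N (dd j) v - sign_average N (dd j) u\<bar>)"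
        unfolding case_prod_beta sum.distrib by (subst sum.swap) simp
      also have "\<dots> \<le> e / 2 + (\<Sum>j=J0..<J N. C * Wt * q ^ (j + 1))"
        using 1 2 by (intro add_mono sum_mono) auto
      also have "(\<Sum>j=J0..<J N. C * Wt * q ^ (j + 1)) = C * Wt * (\<Sum>j=J0..<J N. q ^ (j + 1))"
        by (simp add: sum_distrib_left)
      also have "\<dots> \<le> C * Wt * (q ^ J0 / (1 - q))"
        using C Wt q by (intro mult_left_mono sum_geometric_tail_le) auto
      also have "\<dots> \<le> e / 2" using J0 by simp
      finally show ?thesis by simp
    qed
    have "\<forall>\<^sub>F N in sequentially. J0 \<le> J N" using J_lim by (simp add: filterlim_at_top)
    then have "\<forall>\<^sub>F N in sequentially. \<forall>P. finite P \<longrightarrow>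
        (\<forall>(u, v)\<in>P. u < v \<and> {u..v} \<subseteq> I) \<longrightarrow> disjoint_family_on (\<lambda>(u, v). {u<..<v}) P \<longrightarrow>
        (\<Sum>(u, v)\<in>P. v - u) < \<delta> \<longrightarrow> (\<Sum>(u, v)\<in>P. \<bar>H N v - H N u\<bar>) \<le> e"
      by (rule eventually_mono) (use est in blast)
    then show "\<exists>\<delta>>0. \<forall>\<^sub>F N in sequentially. \<forall>P. finite P \<longrightarrow>
        (\<forall>(u, v)\<in>P. u < v \<and> {u..v} \<subseteq> I) \<longrightarrow> disjoint_family_on (\<lambda>(u, v). {u<..<v}) P \<longrightarrow>
        (\<Sum>(u, v)\<in>P. v - u) < \<delta> \<longrightarrow> (\<Sum>(u, v)\<in>P. \<bar>H N v - H N u\<bar>) \<le> e"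
      using \<delta> by blast
  qed
qed

theorem theorem1p1:
  shows "\<forall>\<epsilon>>0. \<exists>\<gamma>>0. \<forall>\<phi> :: real \<Rightarrow> real.
    (\<exists>\<alpha>. 1 - 2 * \<gamma> \<le> \<alpha> \<and> holder_continuous \<alpha> \<phi>) \<longrightarrow>
    absolutely_continuous_on {2 powr (- 1 / 3) + \<epsilon> <..< 1 - \<epsilon>}
      (\<lambda>l. \<integral>x. \<phi> x \<partial>(bernoulli_convolution l))"
proof (intro allI impI)
  fix \<epsilon> :: real assume \<epsilon>: "\<epsilon> > 0"
  show "\<exists>\<gamma>>0. \<forall>\<phi> :: real \<Rightarrow> real. (\<exists>\<alpha>. 1 - 2 * \<gamma> \<le> \<alpha> \<and> holder_continuous \<alpha> \<phi>) \<longrightarrow>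
    absolutely_continuous_on {2 powr (- 1 / 3) + \<epsilon> <..< 1 - \<epsilon>}
      (\<lambda>l. \<integral>x. \<phi> x \<partial>(bernoulli_convolution l))"
  proof (cases "2 powr (- 1 / 3) + \<epsilon> < 1 - \<epsilon>")
    \<comment> \<open>For large \<epsilon> the interval is empty and any \<gamma> will do.\<close>
    case False
    then have "{2 powr (- 1 / 3) + \<epsilon> <..< 1 - \<epsilon>} = {}" by auto
    then show ?thesis using absolutely_continuous_on_empty by (intro exI[of _ 1]) simp
  next
    case True
    define b0 where "b0 = min (1/2 + \<epsilon> ^ 3) (504/1000)"
    have b0: "1/2 < b0" "b0 \<le> 6/10" 
    using \<epsilon> min.cobounded2[of "1/2 + \<epsilon> ^ 3" "504/1000"] unfolding b0_def by simp_all
    then have "1/2 < (1/2 + b0) / 2" by simp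
    then obtain s where s: "0 < s" "s \<le> 1" "1 < 2 * ((1/2 + b0) / 2) powr (1 + s)"
      by (rule exponent_exists)
    have "(0::real) < 2 powr (- 1 / 3)" by simp
    then have \<epsilon>1: "0 \<le> 1 - \<epsilon>" "1 - \<epsilon> < 1" using True \<epsilon> by linarith+
    then obtain n where n: "(1 - \<epsilon>) ^ n < 6/10" using real_arch_pow_inv[of "6/10" "1 - \<epsilon>"] by auto
    \<comment> \<open>Beyond K no further windows occur: every x in the interval has x^K <= 6/10, so
      finitely many k suffice.\<close>
    define K where "K = max 3 n"
    have "(1 - \<epsilon>) ^ K \<le> (1 - \<epsilon>) ^ n" using \<epsilon>1 by (intro power_decreasing) (auto simp: K_def)
    then have K: "(1 - \<epsilon>) ^ K \<le> 6/10" "3 \<le> K" using n by (auto simp: K_def)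
    have "\<exists>w. window_bound s b0 k w" if "k \<ge> 1" for k
      using that b0 s by (rule window_bound_exists)
    then obtain W where W: "window_bound s b0 k (W k)" if "k \<ge> 1" for k by metis
    show ?thesis
    \<comment> \<open>With \<gamma> = s / 8 the hypothesis on the exponent reads \<alpha> >= 1 -
      s/4, as in the window bounds; s depends on \<epsilon> only through b0.\<close>
    proof (intro exI[of _ "s / 8"] conjI allI impI)
      fix \<phi> :: "real \<Rightarrow> real" assume "\<exists>\<alpha>. 1 - 2 * (s / 8) \<le> \<alpha> \<and> holder_continuous \<alpha> \<phi>"
      then obtain \<alpha> C where \<alpha>: "0 < \<alpha>" "1 - s / 4 \<le> \<alpha>" and C: "\<And>x y. \<bar>\<phi> x - \<phi> y\<bar> \<le> C * \<bar>x - y\<bar> powr \<alpha>"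
        by (auto simp: holder_continuous_def)
      have "C \<ge> 0" using C[of 0 1] by simp
      show "absolutely_continuous_on {2 powr (- 1 / 3) + \<epsilon> <..< 1 - \<epsilon>}
          (\<lambda>l. \<integral>x. \<phi> x \<partial>(bernoulli_convolution l))"
        by (rule absolutely_continuous_bernoulli[OF \<epsilon> True K s(1) W[unfolded b0_def] C \<open>C \<ge> 0\<close> \<alpha>])
    qed (use s in simp)
  qed
qed

end
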